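(* Let $T>0$, let $\varepsilon$ be a nonzero real number with $|\varepsilon|<1$, and let $\Omega=\{(x,t): -\pi<x<\pi,\ 0<t<T\}$. Let $\varphi,\psi\in C^2[-\pi,\pi]$ with $\varphi''',\psi'''\in L_2(-\pi,\pi)$ and $\varphi^{(i)}(-\pi)=\varphi^{(i)}(\pi)$, $\psi^{(i)}(-\pi)=\psi^{(i)}(\pi)$ for $i=0,1,2$. Consider the inverse problem of finding a pair $(u,f)$ with $u\in C^{2,1}_{x,t}(\Omega)$, $f\in C[-\pi,\pi]$, such that $$u_t(x,t)-u_{xx}(x,t)+\varepsilon u_{xx}(-x,t)=f(x),\quad (x,t)\in\Omega,$$ $$u(x,0)=\varphi(x),\quad u(x,T)=\psi(x),\quad x\in[-\pi,\pi],$$ $$u(-\pi,t)=u(\pi,t),\quad u_x(-\pi,t)=u_x(\pi,t),\quad t\in[0,T].$$ Then a unique solution of this problem exists, and it is given by $$u(x,t)=\varphi(x)+\frac tT(\psi_0-\varphi_0)-\sum_{k=1}^\infty\frac{\left(1-e^{-(1-\varepsilon)k^2t}\right)\left(\varphi^{(3)}_{2k}-\psi^{(3)}_{2k}\right)}{\left(1-e^{-(1-\varepsilon)k^2T}\right)k^3}\cos kx+\sum_{k=1}^\infty\frac{\left(1-e^{-(1+\varepsilon)k^2t}\right)\left(\varphi^{(3)}_{1k}-\psi^{(3)}_{1k}\right)}{\left(1-e^{-(1+\varepsilon)k^2T}\right)k^3}\sin kx,$$ $$f(x)=-\varphi''(x)+\varepsilon\varphi''(-x)+\frac{\psi_0-\varphi_0}{T}-\sum_{k=1}^\infty\frac{(1-\varepsilon)\left(\varphi^{(3)}_{2k}-\psi^{(3)}_{2k}\right)}{\left(1-e^{-(1-\varepsilon)k^2T}\right)k}\cos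 kx+\sum_{k=1}^\infty\frac{(1+\varepsilon)\left(\varphi^{(3)}_{1k}-\psi^{(3)}_{1k}\right)}{\left(1-e^{-(1+\varepsilon)k^2T}\right)k}\sin kx,$$ where $$\varphi_0=\frac1{2\pi}\int_{-\pi}^\pi\varphi(x)\,dx,\quad \psi_0=\frac1{2\pi}\int_{-\pi}^\pi\psi(x)\,dx,$$ $$\varphi^{(3)}_{1k}=\frac1\pi\int_{-\pi}^\pi\varphi'''(x)\cos kx\,dx,\quad \varphi^{(3)}_{2k}=\frac1\pi\int_{-\pi}^\pi\varphi'''(x)\sin kx\,dx,$$ $$\psi^{(3)}_{1k}=\frac1\pi\int_{-\pi}^\pi\psi'''(x)\cos kx\,dx,\quad \psi^{(3)}_{2k}=\frac1\pi\int_{-\pi}^\pi\psi'''(x)\sin kx\,dx.$$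
   Context: $C^{2,1}_{x,t}(\Omega)$ denotes functions on $\Omega$ that are twice continuously differentiable in $x$ and once continuously differentiable in $t$. A pair $(u,f)$ with $u\in C^{2,1}_{x,t}(\Omega)$, $f\in C[-\pi,\pi]$ satisfying the equation and conditions is called a regular solution.
   Formalization: A solution is additionally required to have u and u_x continuous on the closed rectangle [-π,π]×[0,T]; with only u∈C^{2,1}(Ω), uniqueness fails (e.g. u=0 for 0<t<T, u(x,0)=φ, u(x,T)=ψ, f=0). *)

theory Defs
  imports "HOL-Analysis.Analysis"
begin

text \<open>Data class: g is C^2 on [-pi,pi] (one-sided derivatives at the endpoints),
  with derivatives g1, g2, g2 is absolutely continuous with (a.e.) derivative g3 in L_2,
  and g, g', g'' are 2pi-periodic at the endpoints.\<close>
definition periodic_data ::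
  "(real \<Rightarrow> real) \<Rightarrow> (real \<Rightarrow> real) \<Rightarrow> (real \<Rightarrow> real) \<Rightarrow> (real \<Rightarrow> real) \<Rightarrow> bool" where
  "periodic_data g g1 g2 g3 \<longleftrightarrow>
     (\<forall>x\<in>{-pi..pi}. (g has_real_derivative g1 x) (at x within {-pi..pi})) \<and>
     (\<forall>x\<in>{-pi..pi}. (g1 has_real_derivative g2 x) (at x within {-pi..pi})) \<and>
     continuous_on {-pi..pi} g2 \<and>
     g3 absolutely_integrable_on {-pi..pi} \<and>
     (\<lambda>x. (g3 x)^2) integrable_on {-pi..pi} \<and>
     (\<forall>x\<in>{-pi..pi}. g2 x = g2 (-pi) + integral {-pi..x} g3) \<and>
     g (-pi) = g pi \<and> g1 (-pi) = g1 pi \<and> g2 (-pi) = g2 pi"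

text \<open>Regular solution (u,f): u in C^{2,1}_{x,t}(Omega) with u, u_x continuous up to
  the closure of Omega (needed for the boundary conditions to be meaningful),
  f in C[-pi,pi], the equation in Omega, and the initial/final/periodic conditions.\<close>
definition regular_solution ::
  "real \<Rightarrow> real \<Rightarrow> (real \<Rightarrow> real) \<Rightarrow> (real \<Rightarrow> real) \<Rightarrow> (real \<Rightarrow> real \<Rightarrow> real) \<Rightarrow> (real \<Rightarrow> real) \<Rightarrow> bool" where
  "regular_solution T \<epsilon> \<phi> \<psi> u f \<longleftrightarrow>
     continuous_on ({-pi..pi} \<times> {0..T}) (\<lambda>(x,t). u x t) \<and>
     continuous_on {-pi..pi} f \<and>
     (\<exists>ux uxx ut.
        (\<forall>x\<in>{-pi..pi}. \<forall>t\<in>{0..T}.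
            ((\<lambda>y. u y t) has_real_derivative ux x t) (at x within {-pi..pi})) \<and>
        continuous_on ({-pi..pi} \<times> {0..T}) (\<lambda>(x,t). ux x t) \<and>
        (\<forall>x\<in>{-pi<..<pi}. \<forall>t\<in>{0<..<T}.
            ((\<lambda>y. ux y t) has_real_derivative uxx x t) (at x) \<and>
            ((\<lambda>s. u x s) has_real_derivative ut x t) (at t)) \<and>
        continuous_on ({-pi<..<pi} \<times> {0<..<T}) (\<lambda>(x,t). uxx x t) \<and>
        continuous_on ({-pi<..<pi} \<times> {0<..<T}) (\<lambda>(x,t). ut x t) \<and>
        (\<forall>x\<in>{-pi<..<pi}. \<forall>t\<in>{0<..<T}. ut x t - uxx x t + \<epsilon> * uxx (-x) t = f x) \<and>
        (\<forall>t\<in>{0..T}. u (-pi) t = u pi t \<and> ux (-pi) t = ux pi t)) \<and>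
     (\<forall>x\<in>{-pi..pi}. u x 0 = \<phi> x \<and> u x T = \<psi> x)"

definition mean0 :: "(real \<Rightarrow> real) \<Rightarrow> real" where
  "mean0 g = (1 / (2*pi)) * integral {-pi..pi} g"

definition fc1 :: "(real \<Rightarrow> real) \<Rightarrow> nat \<Rightarrow> real" where
  "fc1 g k = (1 / pi) * integral {-pi..pi} (\<lambda>x. g x * cos (real k * x))"

definition fc2 :: "(real \<Rightarrow> real) \<Rightarrow> nat \<Rightarrow> real" where
  "fc2 g k = (1 / pi) * integral {-pi..pi} (\<lambda>x. g x * sin (real k * x))"

definition sol_u ::
  "real \<Rightarrow> real \<Rightarrow> (real \<Rightarrow> real) \<Rightarrow> (real \<Rightarrow> real) \<Rightarrow> (real \<Rightarrow> real) \<Rightarrow> (real \<Rightarrow> real)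
   \<Rightarrow> real \<Rightarrow> real \<Rightarrow> real" where
  "sol_u T \<epsilon> \<phi> \<psi> \<phi>3 \<psi>3 x t =
     \<phi> x + t / T * (mean0 \<psi> - mean0 \<phi>)
     - (\<Sum>n. let k = Suc n in
          (1 - exp (-(1-\<epsilon>) * (real k)^2 * t)) * (fc2 \<phi>3 k - fc2 \<psi>3 k)
          / ((1 - exp (-(1-\<epsilon>) * (real k)^2 * T)) * (real k)^3) * cos (real k * x))
     + (\<Sum>n. let k = Suc n in
          (1 - exp (-(1+\<epsilon>) * (real k)^2 * t)) * (fc1 \<phi>3 k - fc1 \<psi>3 k)
          / ((1 - exp (-(1+\<epsilon>) * (real k)^2 * T)) * (real k)^3) * sin (real k * x))"

definition sol_f ::
  "real \<Rightarrow> real \<Rightarrow> (real \<Rightarrow> real) \<Rightarrow> (real \<Rightarrow> real) \<Rightarrow> (real \<Rightarrow> real) \<Rightarrow> (real \<Rightarrow> real) \<Rightarrow> (real \<Rightarrow> real)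
   \<Rightarrow> real \<Rightarrow> real" where
  "sol_f T \<epsilon> \<phi> \<psi> \<phi>2 \<phi>3 \<psi>3 x =
     - \<phi>2 x + \<epsilon> * \<phi>2 (-x) + (mean0 \<psi> - mean0 \<phi>) / T
     - (\<Sum>n. let k = Suc n in
          (1-\<epsilon>) * (fc2 \<phi>3 k - fc2 \<psi>3 k)
          / ((1 - exp (-(1-\<epsilon>) * (real k)^2 * T)) * real k) * cos (real k * x))
     + (\<Sum>n. let k = Suc n in
          (1+\<epsilon>) * (fc1 \<phi>3 k - fc1 \<psi>3 k)
          / ((1 - exp (-(1+\<epsilon>) * (real k)^2 * T)) * real k) * sin (real k * x))"

end

theory Submission
  imports Defs
begin

text \<open>Existence: three integrations by parts turn the coefficients of \<open>\<phi>'''\<close> into \<open>k\<^sup>3\<close> times those of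
  \<open>\<phi>\<close>; by Bessel's inequality they are square summable, so the series for \<open>u\<close>, \<open>u\<^sub>x\<close>, \<open>u\<^sub>x\<^sub>x\<close>, \<open>u\<^sub>t\<close>
  are dominated by \<open>\<Sum> \<bar>a\<^sub>k\<bar> / k\<close> and may be differentiated termwise. Reflection \<open>x \<mapsto> -x\<close> acts by \<open>1\<close>
  on cosines and \<open>-1\<close> on sines, which decouples the equation into heat equations with
  conductivities \<open>1 - \<epsilon>\<close> and \<open>1 + \<epsilon>\<close>. The condition at \<open>t = T\<close> is the convergence of the Fourier
  series of \<open>\<phi>\<close> and \<open>\<psi>\<close>.

  Uniqueness: for zero data every Fourier coefficient \<open>a\<close> of \<open>u\<close> satisfies \<open>a' = - \<mu> a + F\<close> with
  \<open>a = 0\<close> at both \<open>0\<close> and \<open>T\<close>, which forces \<open>F = 0\<close> and \<open>a = 0\<close>; hence \<open>u = 0\<close>, and \<open>f = 0\<close> by the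
  equation.\<close>

subsection \<open>Completeness of the trigonometric system and Bessel's inequality\<close>

text \<open>Two gaps in regularity shape the argument. The third derivatives of the data exist only
  almost everywhere and in \<open>L_2\<close>, so the innermost integration by parts needs a version
  for absolutely continuous functions. Two derivatives in \<open>x\<close> leave just a weight
  \<open>1/k\<close> on the square summable coefficients; this already suffices for absolute
  convergence, uniformly up to \<open>t = 0\<close>, because the time weights are bounded by 1. For
  uniqueness, \<open>uxx\<close> and \<open>ut\<close> are continuous only in the open rectangle.
  The equation is therefore tested on \<open>{-r..r}\<close> with \<open>r < pi\<close>, and
  \<open>r\<close> tends to \<open>pi\<close> only in expressions built from \<open>u\<close>,
  \<open>ux\<close> and \<open>f\<close>. The constant \<open>F\<close> must vanish because the
  integrating factor \<open>exp (\<mu> * t)\<close> gives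
  \<open>exp (\<mu> * t) * a(t) = h(t) * F\<close>, where \<open>h\<close> is the primitive of
  \<open>exp (\<mu> * t)\<close> with \<open>h(0) = 0\<close>; hence \<open>h(T) > 0\<close>, while
  \<open>a(T) = 0\<close>. The response to a constant force is thus proportional to
  \<open>exp (- \<mu> * t) * h(t) = (1 - exp (- \<mu> * t)) / \<mu>\<close>, the origin of the
  quotients in the formula for \<open>u\<close>.\<close>

lemma has_integral_cos_int:
  fixes m :: int
  shows "((\<lambda>x. cos (of_int m * x)) has_integral (if m = 0 then 2 * pi else 0)) {-pi..pi}"
proof (cases "m = 0")
  case True
  then show ?thesis
    using has_integral_const_real[of "1::real" "-pi" pi] by simp
next
  case False
  have "((\<lambda>x. cos (of_int m * x)) has_integral
      (sin (of_int m * pi) / of_int m - sin (of_int m * (-pi)) / of_int m)) {-pi..pi}"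
  proof (rule fundamental_theorem_of_calculus)
    fix x :: real
    show "((\<lambda>x. sin (of_int m * x) / of_int m) has_vector_derivative cos (of_int m * x))
        (at x within {-pi..pi})"
      unfolding has_real_derivative_iff_has_vector_derivative[symmetric]
      using False by (auto intro!: derivative_eq_intros)
  qed simp
  then show ?thesis
    using False by (simp add: sin_npi_int mult.commute)
qed

text \<open>Product-to-sum formulas produce the frequency \<open>int j - int k\<close>, hence the
  integer frequencies above. Positivity of \<open>j\<close> excludes \<open>j = k = 0\<close>, where
  the value is \<open>2 * pi\<close>.\<close>

lemma has_integral_cos_cos:
  fixes j k :: nat
  assumes "j > 0"
  shows "((\<lambda>x. cos (real j * x) * cos (real k * x)) has_integral (if j = k then pi else 0)) {-pi..pi}"
proof -
  have "((\<lambda>x. (cos (of_int (int j - int k) * x) + cos (of_int (int j + int k) * x)) / 2) has_integral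
     ((if int j - int k = 0 then 2 * pi else 0) + (if int j + int k = 0 then 2 * pi else 0)) / 2) {-pi..pi}"
    by (intro has_integral_divide has_integral_add has_integral_cos_int)
  then show ?thesis
    using assms by (simp add: cos_times_cos algebra_simps split: if_splits)
qed

lemma has_integral_sin_sin:
  fixes j k :: nat
  assumes "j > 0"
  shows "((\<lambda>x. sin (real j * x) * sin (real k * x)) has_integral (if j = k then pi else 0)) {-pi..pi}"
proof -
  have "((\<lambda>x. (cos (of_int (int j - int k) * x) - cos (of_int (int j + int k) * x)) / 2) has_integral
     ((if int j - int k = 0 then 2 * pi else 0) - (if int j + int k = 0 then 2 * pi else 0)) / 2) {-pi..pi}"
    by (intro has_integral_divide has_integral_diff has_integral_cos_int)
  then show ?thesis
    using assms by (simp add: sin_times_sin algebra_simps split: if_splits)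
qed

lemma integral_odd_eq_0:
  fixes h :: "real \<Rightarrow> real"
  assumes "\<And>x. x \<in> {-a..a} \<Longrightarrow> h (-x) = - h x"
  shows "integral {-a..a} h = 0"
proof -
  have "integral {-a..a} h = integral {-a..a} (\<lambda>x. h (-x))"
    using Henstock_Kurzweil_Integration.integral_reflect_real[of a "-a" h] by simp
  also have "\<dots> = integral {-a..a} (\<lambda>x. - h x)"
    by (rule Henstock_Kurzweil_Integration.integral_cong) (use assms in auto)
  finally show ?thesis by simp
qed

text \<open>An even function on \<open>[-pi, pi]\<close> is a function of \<open>cos x\<close>, so the algebraic Weierstrass theorem
  for \<open>h (arccos y)\<close> replaces the density of trigonometric polynomials.\<close>

lemma even_eq_0_if_cos_coeffs_0:
  fixes h :: "real \<Rightarrow> real"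
  assumes cont: "continuous_on {-pi..pi} h"
    and even: "\<And>x. x \<in> {-pi..pi} \<Longrightarrow> h (-x) = h x"
    and coeff: "\<And>k::nat. integral {-pi..pi} (\<lambda>x. h x * cos (real k * x)) = 0"
    and x: "x \<in> {-pi..pi}"
  shows "h x = 0"
proof -
  note ci = integrable_continuous_real
  \<comment> \<open>A factor \<open>cos x\<close> turns frequency \<open>k\<close> into the average
    of the frequencies \<open>k + 1\<close> and \<open>|k - 1|\<close>, so induction on the power
    works with \<open>k\<close> arbitrary. The conditional encodes \<open>|k - 1|\<close>, since
    truncated subtraction would give 0 at \<open>k = 0\<close>.\<close>
  have mono: "integral {-pi..pi} (\<lambda>x. h x * cos (real k * x) * cos x ^ n) = 0" for n k
  proof (induction n arbitrary: k)
    case 0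
    then show ?case using coeff by simp
  next
    case (Suc n)
    have *: "h x * cos (real k * x) * cos x ^ Suc n =
      (h x * cos (real (k + 1) * x) * cos x ^ n
        + h x * cos (real (if k = 0 then 1 else k - 1) * x) * cos x ^ n) / 2" for x
    proof -
      have "cos x * cos (real k * x)
          = (cos (real (k + 1) * x) + cos (real (if k = 0 then 1 else k - 1) * x)) / 2"
      proof (cases k)
        case (Suc m)
        have "cos x * cos (real k * x) = (cos (x - real k * x) + cos (x + real k * x)) / 2"
          by (rule cos_times_cos)
        also have "x - real k * x = - (real m * x)" using Suc by (simp add: algebra_simps)
        finally show ?thesis using Suc by (simp add: algebra_simps)
      qed simp
      then have "h x * cos x ^ n * (cos x * cos (real k * x)) = h x * cos x ^ n *
          ((cos (real (k + 1) * x) + cos (real (if k = 0 then 1 else k - 1) * x)) / 2)"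
        by simp
      then show ?thesis by (simp only: power_Suc distrib_left add_divide_distrib times_divide_eq_right mult_ac)
    qed
    have "integral {-pi..pi} (\<lambda>x. h x * cos (real k * x) * cos x ^ Suc n) =
      (integral {-pi..pi} (\<lambda>x. h x * cos (real (k + 1) * x) * cos x ^ n)
      + integral {-pi..pi} (\<lambda>x. h x * cos (real (if k = 0 then 1 else k - 1) * x) * cos x ^ n)) / 2"
      unfolding * by (subst integral_divide, subst Henstock_Kurzweil_Integration.integral_add)
        (auto intro!: ci continuous_intros cont)
    then show ?case unfolding Suc.IH by simp
  qed
  have sq: "integral {-pi..pi} (\<lambda>x. h x * h x) = 0"
  proof -
    define I where "I = integral {-pi..pi} (\<lambda>x. \<bar>h x\<bar>)"
    have I: "I \<ge> 0" unfolding I_def by (rule Henstock_Kurzweil_Integration.integral_nonneg) (auto intro!: ci continuous_intros cont)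
    \<comment> \<open>\<open>h\<close> is orthogonal to every polynomial in \<open>cos x\<close>, so
      one factor \<open>h\<close> may be replaced by \<open>h x - g (cos x)\<close>, which is
      uniformly below \<open>e\<close>. Evenness enters through
      \<open>arccos (cos x) = |x|\<close>.\<close>
    have small: "integral {-pi..pi} (\<lambda>x. h x * h x) \<le> e * I" if "e > 0" for e
    proof -
      have "continuous_on {-1..1} (\<lambda>y. h (arccos y))"
        by (rule continuous_on_compose2[OF cont])
          (auto intro!: continuous_intros simp: arccos_lbound arccos_ubound order_trans[OF _ arccos_lbound])
      then obtain g where g: "real_polynomial_function g" "\<And>y. y \<in> {-1..1} \<Longrightarrow> \<bar>h (arccos y) - g y\<bar> < e"
        by (rule Stone_Weierstrass_real_polynomial_function[OF compact_Icc _ \<open>e > 0\<close>]) auto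
      then obtain a n where a: "g = (\<lambda>y. \<Sum>i\<le>n. a i * y ^ i)"
        unfolding real_polynomial_function_iff_sum by auto
      have "integral {-pi..pi} (\<lambda>x. h x * g (cos x)) = (\<Sum>i\<le>n. integral {-pi..pi} (\<lambda>x. a i * (h x * cos (real 0 * x) * cos x ^ i)))"
        unfolding a by (subst Henstock_Kurzweil_Integration.integral_sum[symmetric])
          (auto intro!: ci continuous_intros cont simp: sum_distrib_left mult_ac)
      then have g0: "integral {-pi..pi} (\<lambda>x. h x * g (cos x)) = 0"
        unfolding Henstock_Kurzweil_Integration.integral_mult_right mono by simp
      have cg: "continuous_on {-pi..pi} (\<lambda>x. g (cos x))"
        unfolding a by (intro continuous_intros)
      have "integral {-pi..pi} (\<lambda>x. h x * h x) = integral {-pi..pi} (\<lambda>x. h x * (h x - g (cos x)))"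
        using g0 by (simp add: right_diff_distrib, subst Henstock_Kurzweil_Integration.integral_diff)
          (auto intro!: ci continuous_intros cont cg)
      also have "\<dots> \<le> integral {-pi..pi} (\<lambda>x. e * \<bar>h x\<bar>)"
      proof (rule integral_le)
        fix x :: real assume x: "x \<in> {-pi..pi}"
        have "arccos (cos x) = \<bar>x\<bar>" using x by (intro arccos_cos_eq_abs) auto
        moreover have "h \<bar>x\<bar> = h x" using even[OF x] by (auto simp: abs_if)
        ultimately have "\<bar>h x - g (cos x)\<bar> < e" using g(2)[of "cos x"] by simp
        then have "\<bar>h x\<bar> * \<bar>h x - g (cos x)\<bar> \<le> \<bar>h x\<bar> * e" by (intro mult_left_mono) auto
        then show "h x * (h x - g (cos x)) \<le> e * \<bar>h x\<bar>"
          by (metis abs_ge_self abs_mult mult.commute order_trans)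
      qed (auto intro!: ci continuous_intros cont cg)
      also have "\<dots> = e * I" unfolding I_def by simp
      finally show ?thesis .
    qed
    have "integral {-pi..pi} (\<lambda>x. h x * h x) \<le> 0"
    proof (rule field_le_epsilon)
      fix e :: real assume e: "e > 0"
      have "e / (I + 1) * I \<le> e" using I e by (simp add: field_simps)
      then show "integral {-pi..pi} (\<lambda>x. h x * h x) \<le> 0 + e"
        using small[of "e / (I + 1)"] I e by simp
    qed
    moreover have "integral {-pi..pi} (\<lambda>x. h x * h x) \<ge> 0"
      by (rule Henstock_Kurzweil_Integration.integral_nonneg) (auto intro!: ci continuous_intros cont)
    ultimately show ?thesis by simp
  qed
  have "\<forall>x\<in>{-pi..pi}. h x * h x = 0"
    using sq by (subst (asm) integral_eq_0_iff) (auto intro!: continuous_intros cont)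
  with x show ?thesis by auto
qed

text \<open>The odd part \<open>h\<close> of \<open>f\<close> reduces to the even case because \<open>h x * sin x\<close> is even.\<close>

lemma eq_0_if_fourier_coeffs_0:
  fixes f :: "real \<Rightarrow> real"
  assumes cont: "continuous_on {-pi..pi} f"
    and cosc: "\<And>k::nat. integral {-pi..pi} (\<lambda>x. f x * cos (real k * x)) = 0"
    and sinc: "\<And>k::nat. integral {-pi..pi} (\<lambda>x. f x * sin (real k * x)) = 0"
    and x: "x \<in> {-pi..pi}"
  shows "f x = 0"
proof -
  note ci = integrable_continuous_real
  have cont': "continuous_on {-pi..pi} (\<lambda>x. f (-x))"
    by (rule continuous_on_compose2[OF cont]) (auto intro!: continuous_intros)
  have refl: "integral {-pi..pi} (\<lambda>x. g (-x)) = integral {-pi..pi} g" for g :: "real \<Rightarrow> real"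
    using Henstock_Kurzweil_Integration.integral_reflect_real[of pi "-pi" g] by simp
  have cosc': "integral {-pi..pi} (\<lambda>x. f (-x) * cos (real k * x)) = 0" for k
    using refl[of "\<lambda>x. f x * cos (real k * x)"] cosc by simp
  have sinc': "integral {-pi..pi} (\<lambda>x. f (-x) * sin (real k * x)) = 0" for k
    using refl[of "\<lambda>x. f x * sin (real k * x)"] sinc by simp
  have ev: "f y + f (-y) = 0" if "y \<in> {-pi..pi}" for y
  proof (rule even_eq_0_if_cos_coeffs_0[where h="\<lambda>x. f x + f (-x)"])
    fix k :: nat
    show "integral {-pi..pi} (\<lambda>x. (f x + f (- x)) * cos (real k * x)) = 0"
      unfolding distrib_right
      by (subst Henstock_Kurzweil_Integration.integral_add)
        (auto intro!: ci continuous_intros cont cont' simp: cosc cosc')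
  qed (use that in \<open>auto intro!: continuous_intros cont cont'\<close>)
  have od: "(f y - f (-y)) * sin y = 0" if "y \<in> {-pi..pi}" for y
  proof (rule even_eq_0_if_cos_coeffs_0[where h="\<lambda>x. (f x - f (-x)) * sin x"])
    fix k :: nat
    \<comment> \<open>The second term is \<open>- sin ((k - 1) * x)\<close>, written with frequency
      \<open>|k - 1|\<close>; for \<open>k = 0\<close> oddness of the sine flips its sign.\<close>
    have *: "sin x * cos (real k * x) = (sin (real (k + 1) * x) + (if k = 0 then 1 else -1) * sin (real (if k = 0 then 1 else k - 1) * x)) / 2" for x
    proof (cases k)
      case (Suc m)
      have "sin x * cos (real k * x) = (sin (x + real k * x) + sin (x - real k * x)) / 2"
        by (rule sin_times_cos)
      also have "x - real k * x = - (real m * x)" using Suc by (simp add: algebra_simps)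
      finally show ?thesis using Suc by (simp add: algebra_simps)
    qed simp
    have s0: "integral {-pi..pi} (\<lambda>x. (f x - f (- x)) * sin (real j * x)) = 0" for j
      unfolding left_diff_distrib
      by (subst Henstock_Kurzweil_Integration.integral_diff)
        (auto intro!: ci continuous_intros cont cont' simp: sinc sinc')
    have expand: "w * ((p + c * q) / 2) = (1/2) * (w * p) + (c / 2) * (w * q)" for w p c q :: real
      by (simp add: field_simps)
    have **: "(f x - f (- x)) * sin x * cos (real k * x) =
       (1/2) * ((f x - f (- x)) * sin (real (k + 1) * x)) + ((if k = 0 then 1 else -1) / 2) * ((f x - f (-x)) * sin (real (if k = 0 then 1 else k - 1) * x))" for x
      unfolding mult.assoc[of _ "sin x"] * by (rule expand)
    have "integral {-pi..pi} (\<lambda>x. (f x - f (- x)) * sin x * cos (real k * x)) =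
       (1/2) * integral {-pi..pi} (\<lambda>x. (f x - f (- x)) * sin (real (k + 1) * x))
       + ((if k = 0 then 1 else -1) / 2) * integral {-pi..pi} (\<lambda>x. (f x - f (-x)) * sin (real (if k = 0 then 1 else k - 1) * x))"
      unfolding ** Henstock_Kurzweil_Integration.integral_mult_right[symmetric]
      by (rule Henstock_Kurzweil_Integration.integral_add)
        (intro ci continuous_intros cont cont')+
    then show "integral {-pi..pi} (\<lambda>x. (f x - f (- x)) * sin x * cos (real k * x)) = 0"
      unfolding s0 by simp
  qed (use that in \<open>auto intro!: continuous_intros cont cont' simp: algebra_simps\<close>)
  \<comment> \<open>Dividing by \<open>sin y\<close> fails at 0 and at both endpoints. At 0 the
    vanishing even part alone decides, and continuity reaches the endpoints.\<close>
  have "f y = 0" if "y \<in> {-pi<..<pi} - {0}" for y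
  proof -
    have "sin y \<noteq> 0"
    proof (cases "y > 0")
      case True then show ?thesis using sin_gt_zero[of y] that by auto
    next
      case False then show ?thesis using sin_gt_zero[of "-y"] that by auto
    qed
    then show ?thesis using ev[of y] od[of y] that by auto
  qed
  then have "f y = 0" if "y \<in> {-pi<..<pi}" for y
    using ev[of 0] that by (cases "y = 0") auto
  moreover have "x \<in> closure {-pi<..<pi}" using x by simp
  ultimately show ?thesis
    using continuous_constant_on_closure[of "{-pi<..<pi}" f 0 x] cont by auto
qed

section \<open>Bessel's inequality and weighted summability of Fourier coefficients\<close>

lemma absolutely_integrable_mult_continuous:
  fixes g s :: "real \<Rightarrow> real"
  assumes "g absolutely_integrable_on {a..b}" "continuous_on {a..b} s"
  shows "(\<lambda>x. g x * s x) absolutely_integrable_on {a..b}"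
proof -
  have "(\<lambda>x. s x * g x) absolutely_integrable_on {a..b}"
    by (rule absolutely_integrable_bounded_measurable_product_real)
      (use assms in \<open>auto intro!: continuous_imp_measurable_on_sets_lebesgue compact_imp_bounded compact_continuous_image\<close>)
  then show ?thesis by (simp add: mult.commute)
qed

text \<open>The integral of \<open>(g - (1/pi) * (\<Sum>k\<in>N. c k * e k))^2\<close> is
  nonnegative. The inner products \<open>c k\<close> are not normalised while each
  \<open>e k\<close> has squared norm \<open>pi\<close>, hence the factor \<open>1/pi\<close> in the
  projection and the bound \<open>pi\<close> times the integral of \<open>g^2\<close>.\<close>

lemma bessel_summable:
  fixes e :: "nat \<Rightarrow> real \<Rightarrow> real"
  assumes cont: "\<And>k. continuous_on {-pi..pi} (e k)"
    and orth: "\<And>j k. ((\<lambda>x. e j x * e k x) has_integral (if j = k then pi else 0)) {-pi..pi}"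
    and g: "g absolutely_integrable_on {-pi..pi}" and g2: "(\<lambda>x. (g x)\<^sup>2) integrable_on {-pi..pi}"
  shows "summable (\<lambda>k. (integral {-pi..pi} (\<lambda>x. g x * e k x))\<^sup>2)"
proof (rule bounded_imp_summable)
  define c where "c k = integral {-pi..pi} (\<lambda>x. g x * e k x)" for k
  have gi: "((\<lambda>x. g x * e k x) has_integral c k) {-pi..pi}" for k
    unfolding c_def
    using absolutely_integrable_mult_continuous[OF g cont, of k]
    by (intro integrable_integral) (auto simp: absolutely_integrable_on_def)
  fix n :: nat
  define N where "N = {..n}"
  have "((\<lambda>x. (g x)\<^sup>2 - 2 / pi * (\<Sum>k\<in>N. c k * (g x * e k x))
       + (1 / pi\<^sup>2) * (\<Sum>j\<in>N. \<Sum>k\<in>N. c j * c k * (e j x * e k x)))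
     has_integral (integral {-pi..pi} (\<lambda>x. (g x)\<^sup>2) - 2 / pi * (\<Sum>k\<in>N. c k * c k)
       + (1 / pi\<^sup>2) * (\<Sum>j\<in>N. \<Sum>k\<in>N. c j * c k * (if j = k then pi else 0)))) {-pi..pi}"
    by (intro has_integral_add has_integral_diff has_integral_mult_right has_integral_sum
      integrable_integral g2 gi orth) (auto simp: N_def)
  also have "(\<lambda>x. (g x)\<^sup>2 - 2 / pi * (\<Sum>k\<in>N. c k * (g x * e k x))
       + (1 / pi\<^sup>2) * (\<Sum>j\<in>N. \<Sum>k\<in>N. c j * c k * (e j x * e k x)))
     = (\<lambda>x. (g x - (1 / pi) * (\<Sum>k\<in>N. c k * e k x))\<^sup>2)"
  proof
    fix x
    define S where "S = (\<Sum>k\<in>N. c k * e k x)"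
    have 1: "(\<Sum>k\<in>N. c k * (g x * e k x)) = g x * S"
      unfolding S_def by (simp add: sum_distrib_left mult_ac)
    have 2: "(\<Sum>j\<in>N. \<Sum>k\<in>N. c j * c k * (e j x * e k x)) = S * S"
      unfolding S_def sum_product by (simp add: mult_ac)
    show "(g x)\<^sup>2 - 2 / pi * (\<Sum>k\<in>N. c k * (g x * e k x))
       + (1 / pi\<^sup>2) * (\<Sum>j\<in>N. \<Sum>k\<in>N. c j * c k * (e j x * e k x))
      = (g x - (1 / pi) * (\<Sum>k\<in>N. c k * e k x))\<^sup>2"
      unfolding 1 2 S_def[symmetric] by (simp add: field_simps power2_eq_square)
  qed
  also have "(\<Sum>j\<in>N. \<Sum>k\<in>N. c j * c k * (if j = k then pi else 0)) = pi * (\<Sum>j\<in>N. c j * c j)"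
    by (simp add: N_def sum_distrib_left if_distrib mult_ac cong: if_cong)
  finally have "0 \<le> integral {-pi..pi} (\<lambda>x. (g x)\<^sup>2) - 2 / pi * (\<Sum>k\<in>N. c k * c k)
       + (1 / pi\<^sup>2) * (pi * (\<Sum>j\<in>N. c j * c j))"
    by (rule has_integral_nonneg) auto
  then have "(\<Sum>k\<in>N. c k * c k) \<le> pi * integral {-pi..pi} (\<lambda>x. (g x)\<^sup>2)"
    by (simp add: field_simps power2_eq_square)
  then show "(\<Sum>k\<le>n. (integral {-pi..pi} (\<lambda>x. g x * e k x))\<^sup>2) \<le> pi * integral {-pi..pi} (\<lambda>x. (g x)\<^sup>2)"
    by (simp add: N_def c_def power2_eq_square)
qed simp

text \<open>The inequality \<open>2 * a * b \<le> a^2 + b^2\<close> with \<open>a = |c n|\<close>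
  and \<open>b = 1 / Suc n\<close> trades square summability for absolute summability with weight
  \<open>1/k\<close>.\<close>

lemma summable_fourier_coeffs_div:
  assumes g: "g absolutely_integrable_on {-pi..pi}" and g2: "(\<lambda>x. (g x)\<^sup>2) integrable_on {-pi..pi}"
  shows "summable (\<lambda>n. \<bar>fc1 g (Suc n)\<bar> / real (Suc n))" "summable (\<lambda>n. \<bar>fc2 g (Suc n)\<bar> / real (Suc n))"
proof -
  have *: "summable (\<lambda>n. \<bar>c n\<bar> / real (Suc n))" if "summable (\<lambda>n. (c n)\<^sup>2)" for c :: "nat \<Rightarrow> real"
  proof (rule summable_comparison_test')
    have "summable (\<lambda>n. inverse (real (Suc n) ^ 2))"
      using inverse_power_summable[of 2, where 'a=real] by (subst summable_Suc_iff) auto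
    then show "summable (\<lambda>n. (c n)\<^sup>2 + inverse (real (Suc n) ^ 2))"
      by (intro summable_add that)
    fix n :: nat
    have "2 * (\<bar>c n\<bar> * inverse (real (Suc n))) \<le> \<bar>c n\<bar>\<^sup>2 + (inverse (real (Suc n)))\<^sup>2"
      using sum_squares_bound[of "\<bar>c n\<bar>" "inverse (real (Suc n))"] by (simp add: mult.assoc)
    moreover have "0 \<le> \<bar>c n\<bar> * inverse (real (Suc n))" by simp
    ultimately have "\<bar>c n\<bar> * inverse (real (Suc n)) \<le> \<bar>c n\<bar>\<^sup>2 + (inverse (real (Suc n)))\<^sup>2"
      by linarith
    then show "norm (\<bar>c n\<bar> / real (Suc n)) \<le> (c n)\<^sup>2 + inverse (real (Suc n) ^ 2)"
      by (simp add: divide_inverse power_inverse)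
  qed
  have "summable (\<lambda>n. (integral {-pi..pi} (\<lambda>x. g x * cos (real (Suc n) * x)))\<^sup>2)"
    by (rule bessel_summable[OF _ _ g g2])
      (use has_integral_cos_cos[of "Suc j" "Suc k" for j k] in \<open>auto intro!: continuous_intros simp del: of_nat_Suc\<close>)
  from summable_mult[OF *[OF this], of "1/pi"]
  show "summable (\<lambda>n. \<bar>fc1 g (Suc n)\<bar> / real (Suc n))"
    by (simp add: fc1_def abs_mult)
  have "summable (\<lambda>n. (integral {-pi..pi} (\<lambda>x. g x * sin (real (Suc n) * x)))\<^sup>2)"
    by (rule bessel_summable[OF _ _ g g2])
      (use has_integral_sin_sin[of "Suc j" "Suc k" for j k] in \<open>auto intro!: continuous_intros simp del: of_nat_Suc\<close>)
  from summable_mult[OF *[OF this], of "1/pi"]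
  show "summable (\<lambda>n. \<bar>fc2 g (Suc n)\<bar> / real (Suc n))"
    by (simp add: fc2_def abs_mult)
qed

subsection \<open>Fourier coefficients of the data\<close>

text \<open>The defect \<open>H\<close> in the formula satisfies \<open>\<bar>H y - H x\<bar> \<le> 2 L (V y - V x) (y - x)\<close> with \<open>V\<close> the
  (continuous) integral of \<open>\<bar>g\<bar>\<close>, so \<open>H\<close> has derivative zero everywhere, although \<open>G\<close> is
  differentiable only almost everywhere.\<close>

lemma integral_by_parts_absolutely_continuous:
  fixes g G s s' :: "real \<Rightarrow> real"
  assumes ab: "a \<le> b" and g: "g absolutely_integrable_on {a..b}"
    and G: "\<And>x. x \<in> {a..b} \<Longrightarrow> G x = G a + integral {a..x} g"
    and s: "\<And>x. x \<in> {a..b} \<Longrightarrow> (s has_real_derivative s' x) (at x within {a..b})"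
    and s': "continuous_on {a..b} s'"
  shows "integral {a..b} (\<lambda>x. g x * s x) = G b * s b - G a * s a - integral {a..b} (\<lambda>x. G x * s' x)"
proof -
  have conts: "continuous_on {a..b} s"
    using s by (intro DERIV_continuous_on) auto
  obtain L where L: "L \<ge> 0" "\<And>x. x \<in> {a..b} \<Longrightarrow> \<bar>s' x\<bar> \<le> L"
  proof -
    have "bounded (s' ` {a..b})" by (intro compact_imp_bounded compact_continuous_image s') simp
    then obtain L where "L > 0" "\<forall>y\<in>s' ` {a..b}. norm y \<le> L" unfolding bounded_pos by blast
    then show ?thesis by (intro that[of L]) auto
  qed
  have gi: "g integrable_on {a..b}" and gai: "(\<lambda>x. \<bar>g x\<bar>) integrable_on {a..b}"
    using g by (auto simp: absolutely_integrable_on_def)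
  have gs: "(\<lambda>x. g x * s x) integrable_on {a..b}"
    using absolutely_integrable_mult_continuous[OF g conts] by (auto simp: absolutely_integrable_on_def)
  have contG: "continuous_on {a..b} G"
    by (rule continuous_on_eq[OF continuous_on_add[OF continuous_on_const indefinite_integral_continuous_1[OF gi]]])
      (rule G[symmetric])
  have Gs: "(\<lambda>x. G x * s' x) integrable_on {a..b}"
    by (intro integrable_continuous_real continuous_intros contG s')
  define V where "V x = integral {a..x} (\<lambda>x. \<bar>g x\<bar>)" for x
  define H where "H y = integral {a..y} (\<lambda>x. g x * s x) - G y * s y + integral {a..y} (\<lambda>x. G x * s' x)" for y
  have sub: "h integrable_on {x..y}" if "h integrable_on {a..b}" "a \<le> x" "y \<le> b" for h :: "real \<Rightarrow> real" and x y
    using that by (auto intro: integrable_on_subinterval)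
  have comb: "integral {a..y} h - integral {a..x} h = integral {x..y} h"
    if "h integrable_on {a..b}" "a \<le> x" "x \<le> y" "y \<le> b" for h :: "real \<Rightarrow> real" and x y
    using Henstock_Kurzweil_Integration.integral_combine[of a x y h] sub[OF that(1), of a y] that by simp
  have bound: "\<bar>H y - H x\<bar> \<le> 2 * L * (V y - V x) * (y - x)"
    if xy: "a \<le> x" "x \<le> y" "y \<le> b" for x y
  proof -
    have VV: "V y - V x = integral {x..y} (\<lambda>x. \<bar>g x\<bar>)"
      unfolding V_def by (rule comb[OF gai xy])
    have ss: "s v - s u = integral {u..v} s'" if "x \<le> u" "u \<le> v" "v \<le> y" for u v
    proof -
      have "(s' has_integral (s v - s u)) {u..v}"
        by (rule fundamental_theorem_of_calculus[OF that(2)])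
          (use that xy in \<open>auto simp: has_real_derivative_iff_has_vector_derivative[symmetric]
            intro!: DERIV_subset[OF s]\<close>)
      then show ?thesis by (simp add: integral_unique)
    qed
    have sl: "\<bar>s v - s u\<bar> \<le> L * (y - x)" if "x \<le> u" "u \<le> v" "v \<le> y" for u v
    proof -
      have "norm (integral {u..v} s') \<le> L * (v - u)"
        by (rule integral_bound) (use that xy L s' in \<open>auto intro: continuous_on_subset\<close>)
      also have "\<dots> \<le> L * (y - x)" using that L by (intro mult_left_mono) auto
      finally show ?thesis using ss[OF that] by simp
    qed
    have GG: "G v - G u = integral {u..v} g" if "x \<le> u" "u \<le> v" "v \<le> y" for u v
      using comb[OF gi, of u v] G[of u] G[of v] that xy by auto
    have Gl: "\<bar>G v - G x\<bar> \<le> V y - V x" if "x \<le> v" "v \<le> y" for v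
    proof -
      have "norm (integral {x..v} g) \<le> integral {x..v} (\<lambda>x. \<bar>g x\<bar>)"
        by (rule Henstock_Kurzweil_Integration.integral_norm_bound_integral)
          (use that xy in \<open>auto intro!: sub[OF gi] sub[OF gai]\<close>)
      also have "\<dots> \<le> integral {x..y} (\<lambda>x. \<bar>g x\<bar>)"
        by (rule integral_subset_le) (use that xy in \<open>auto intro!: sub[OF gai]\<close>)
      finally show ?thesis using GG[of x v] VV that by simp
    qed
    have i1: "(\<lambda>z. g z * s z) integrable_on {x..y}" "g integrable_on {x..y}"
        "(\<lambda>z. G z * s' z) integrable_on {x..y}" "s' integrable_on {x..y}"
      using xy sub[OF gs] sub[OF gi] sub[OF Gs] sub[OF integrable_continuous_real[OF s']] by auto
    have "H y - H x = integral {x..y} (\<lambda>x. g x * s x) - (G y * s y - G x * s x) + integral {x..y} (\<lambda>x. G x * s' x)"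
      unfolding H_def using comb[OF gs xy] comb[OF Gs xy] by simp
    \<comment> \<open>Freezing \<open>s\<close> at the right endpoint and \<open>G\<close> at the
      left one makes the increment of \<open>H\<close> a sum of two integrals, each with two small
      factors. Each is at most \<open>L * (V y - V x) * (y - x)\<close>, whence the constant
      2.\<close>
    also have "G y * s y - G x * s x = (G y - G x) * s y + G x * (s y - s x)"
      by (simp add: algebra_simps)
    also have "\<dots> = integral {x..y} (\<lambda>z. g z * s y) + integral {x..y} (\<lambda>z. G x * s' z)"
      using GG[of x y] ss[of x y] xy by simp
    also have "integral {x..y} (\<lambda>x. g x * s x)
        - (integral {x..y} (\<lambda>z. g z * s y) + integral {x..y} (\<lambda>z. G x * s' z)) + integral {x..y} (\<lambda>x. G x * s' x)
      = integral {x..y} (\<lambda>z. g z * (s z - s y)) + integral {x..y} (\<lambda>z. (G z - G x) * s' z)"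
      unfolding left_diff_distrib right_diff_distrib
      by (subst (1 2) Henstock_Kurzweil_Integration.integral_diff)
        (use i1 in \<open>auto intro!: integrable_on_mult_left integrable_on_mult_right\<close>)
    finally have HH: "H y - H x = integral {x..y} (\<lambda>z. g z * (s z - s y)) + integral {x..y} (\<lambda>z. (G z - G x) * s' z)" .
    have "norm (integral {x..y} (\<lambda>z. g z * (s z - s y))) \<le> integral {x..y} (\<lambda>z. \<bar>g z\<bar> * (L * (y - x)))"
    proof (rule Henstock_Kurzweil_Integration.integral_norm_bound_integral)
      show "(\<lambda>z. g z * (s z - s y)) integrable_on {x..y}"
        unfolding right_diff_distrib
        by (intro Henstock_Kurzweil_Integration.integrable_diff i1 integrable_on_mult_left)
      show "(\<lambda>z. \<bar>g z\<bar> * (L * (y - x))) integrable_on {x..y}"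
        using xy by (intro integrable_on_mult_left sub[OF gai]) auto
      fix z assume "z \<in> {x..y}"
      then have "\<bar>s z - s y\<bar> \<le> L * (y - x)" using sl[of z y] by (auto simp: abs_minus_commute)
      then show "norm (g z * (s z - s y)) \<le> \<bar>g z\<bar> * (L * (y - x))"
        by (auto simp: abs_mult intro!: mult_left_mono)
    qed
    also have "\<dots> = L * (V y - V x) * (y - x)" unfolding VV by simp
    finally have 1: "\<bar>integral {x..y} (\<lambda>z. g z * (s z - s y))\<bar> \<le> L * (V y - V x) * (y - x)" by simp
    have "norm (integral {x..y} (\<lambda>z. (G z - G x) * s' z)) \<le> (L * (V y - V x)) * (y - x)"
    proof (rule integral_bound)
      show "continuous_on {x..y} (\<lambda>z. (G z - G x) * s' z)"
        by (rule continuous_on_subset[of "{a..b}"]) (use xy in \<open>auto intro!: continuous_intros contG s'\<close>)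
      fix z assume z: "z \<in> {x..y}"
      have "\<bar>G z - G x\<bar> * \<bar>s' z\<bar> \<le> (V y - V x) * L"
        using z xy Gl[of z] L(2)[of z] by (intro mult_mono) auto
      then show "norm ((G z - G x) * s' z) \<le> L * (V y - V x)"
        by (simp add: abs_mult mult.commute)
    qed (use xy in simp)
    then show ?thesis using 1 HH by simp
  qed
  have contV: "continuous_on {a..b} V"
    unfolding V_def by (rule indefinite_integral_continuous_1[OF gai])
  have "(H has_field_derivative 0) (at x within {a..b})" if x: "x \<in> {a..b}" for x
  proof -
    have "((\<lambda>y. 2 * L * \<bar>V y - V x\<bar>) \<longlongrightarrow> 2 * L * \<bar>V x - V x\<bar>) (at x within {a..b})"
      using contV x by (intro tendsto_intros) (auto simp: continuous_on_def)
    then have lim: "((\<lambda>y. 2 * L * \<bar>V y - V x\<bar>) \<longlongrightarrow> 0) (at x within {a..b})" by simp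
    have "((\<lambda>y. (H y - H x) / (y - x)) \<longlongrightarrow> 0) (at x within {a..b})"
    proof (rule Lim_null_comparison[OF _ lim])
      have "norm ((H y - H x) / (y - x)) \<le> 2 * L * \<bar>V y - V x\<bar>" if y: "y \<in> {a..b}" "y \<noteq> x" for y
      proof -
        have "V u \<le> V v" if "a \<le> u" "u \<le> v" "v \<le> b" for u v
          using comb[OF gai that] Henstock_Kurzweil_Integration.integral_nonneg[OF sub[OF gai, of u v]] that
          by (simp add: V_def)
        then have "\<bar>H y - H x\<bar> \<le> 2 * L * \<bar>V y - V x\<bar> * \<bar>y - x\<bar>"
          using bound[of x y] bound[of y x] x y by (cases "x \<le> y") (auto simp: abs_minus_commute)
        then show ?thesis using y by (simp add: abs_divide pos_divide_le_eq)
      qed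
      then show "\<forall>\<^sub>F y in at x within {a..b}. norm ((H y - H x) / (y - x)) \<le> 2 * L * \<bar>V y - V x\<bar>"
        by (auto simp: eventually_at_filter)
    qed
    then show ?thesis by (simp add: has_field_derivative_iff)
  qed
  then obtain c where c: "\<And>x. x \<in> {a..b} \<Longrightarrow> H x = c"
    using has_field_derivative_zero_constant[of "{a..b}" H] by auto
  have "H b = H a" using c ab by simp
  then show ?thesis unfolding H_def by simp
qed

lemma integral_by_parts_C1:
  fixes G g s s' :: "real \<Rightarrow> real"
  assumes ab: "a \<le> b"
    and G: "\<And>x. x \<in> {a..b} \<Longrightarrow> (G has_real_derivative g x) (at x within {a..b})"
    and g: "continuous_on {a..b} g"
    and s: "\<And>x. x \<in> {a..b} \<Longrightarrow> (s has_real_derivative s' x) (at x within {a..b})"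
    and s': "continuous_on {a..b} s'"
  shows "integral {a..b} (\<lambda>x. g x * s x) = G b * s b - G a * s a - integral {a..b} (\<lambda>x. G x * s' x)"
proof (rule integral_by_parts_absolutely_continuous[OF ab _ _ s s'])
  show "g absolutely_integrable_on {a..b}"
    using g by (rule absolutely_integrable_continuous_real)
  fix x assume x: "x \<in> {a..b}"
  have "(g has_integral (G x - G a)) {a..x}"
    by (rule fundamental_theorem_of_calculus)
      (use x in \<open>auto simp: has_real_derivative_iff_has_vector_derivative[symmetric]
        intro!: DERIV_subset[OF G]\<close>)
  then show "G x = G a + integral {a..x} g" by (simp add: integral_unique)
qed

lemma sin_nat_pi [simp]: "sin (real k * pi) = 0"
  by (simp add: sin_npi)

text \<open>Each integration by parts swaps sine and cosine and costs a factor \<open>k\<close>; an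
  odd number of them exchanges the two families. Boundary terms vanish for sines because
  \<open>sin (k * pi) = 0\<close> and for cosines by periodicity of \<open>g\<close>,
  \<open>g1\<close>, \<open>g2\<close>. Only the first integration, from \<open>g3\<close> to
  \<open>g2\<close>, needs absolute continuity.\<close>

lemma periodic_data_fourier_coeffs:
  assumes P: "periodic_data g g1 g2 g3"
  shows "integral {-pi..pi} (\<lambda>x. g3 x * sin (real k * x)) = real k ^ 3 * integral {-pi..pi} (\<lambda>x. g x * cos (real k * x))"
    and "integral {-pi..pi} (\<lambda>x. g3 x * cos (real k * x)) = - (real k ^ 3) * integral {-pi..pi} (\<lambda>x. g x * sin (real k * x))"
proof -
  have g: "\<And>x. x \<in> {-pi..pi} \<Longrightarrow> (g has_real_derivative g1 x) (at x within {-pi..pi})"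
    and g1: "\<And>x. x \<in> {-pi..pi} \<Longrightarrow> (g1 has_real_derivative g2 x) (at x within {-pi..pi})"
    and cg2: "continuous_on {-pi..pi} g2" and g3: "g3 absolutely_integrable_on {-pi..pi}"
    and g2: "\<And>x. x \<in> {-pi..pi} \<Longrightarrow> g2 x = g2 (-pi) + integral {-pi..x} g3"
    and per: "g (-pi) = g pi" "g1 (-pi) = g1 pi" "g2 (-pi) = g2 pi"
    using P unfolding periodic_data_def by blast+
  have cg1: "continuous_on {-pi..pi} g1"
    using g1 by (intro DERIV_continuous_on) auto
  define S where "S h = integral {-pi..pi} (\<lambda>x. h x * sin (real k * x))" for h
  define C where "C h = integral {-pi..pi} (\<lambda>x. h x * cos (real k * x))" for h
  have ds: "((\<lambda>x. sin (real k * x)) has_real_derivative real k * cos (real k * x)) (at x within A)"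
    and dc: "((\<lambda>x. cos (real k * x)) has_real_derivative - real k * sin (real k * x)) (at x within A)" for x A
    by (auto intro!: derivative_eq_intros)
  have cc: "continuous_on {-pi..pi} (\<lambda>x. real k * cos (real k * x))"
    "continuous_on {-pi..pi} (\<lambda>x. - real k * sin (real k * x))"
    by (auto intro!: continuous_intros)
  have pull: "integral {-pi..pi} (\<lambda>x. h x * (real k * cos (real k * x))) = real k * C h"
    "integral {-pi..pi} (\<lambda>x. h x * (- real k * sin (real k * x))) = - real k * S h" for h
    unfolding C_def S_def Henstock_Kurzweil_Integration.integral_mult_right[symmetric]
    by (simp_all add: mult_ac)
  have pp: "- pi \<le> pi" by simp
  have S3: "S g3 = - real k * C g2"
    using integral_by_parts_absolutely_continuous[OF pp g3 g2 ds cc(1)] unfolding pull by (simp add: S_def)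
  have C3: "C g3 = real k * S g2"
    using integral_by_parts_absolutely_continuous[OF pp g3 g2 dc cc(2)] per unfolding pull by (simp add: C_def)
  have S2: "S g2 = - real k * C g1"
    using integral_by_parts_C1[OF pp g1 cg2 ds cc(1)] unfolding pull by (simp add: S_def)
  have C2: "C g2 = real k * S g1"
    using integral_by_parts_C1[OF pp g1 cg2 dc cc(2)] per unfolding pull by (simp add: C_def)
  have S1: "S g1 = - real k * C g"
    using integral_by_parts_C1[OF pp g cg1 ds cc(1)] unfolding pull by (simp add: S_def)
  have C1: "C g1 = real k * S g"
    using integral_by_parts_C1[OF pp g cg1 dc cc(2)] per unfolding pull by (simp add: C_def)
  show "integral {-pi..pi} (\<lambda>x. g3 x * sin (real k * x)) = real k ^ 3 * integral {-pi..pi} (\<lambda>x. g x * cos (real k * x))"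
    using S3 C2 S1 unfolding S_def C_def by (simp add: power3_eq_cube)
  show "integral {-pi..pi} (\<lambda>x. g3 x * cos (real k * x)) = - (real k ^ 3) * integral {-pi..pi} (\<lambda>x. g x * sin (real k * x))"
    using C3 S2 C1 unfolding S_def C_def by (simp add: power3_eq_cube)
qed

section \<open>Termwise integration and the Fourier series of the data\<close>

lemma continuous_on_suminf:
  fixes f :: "nat \<Rightarrow> 'a::topological_space \<Rightarrow> real"
  assumes "\<And>n. continuous_on A (f n)" "\<And>n x. x \<in> A \<Longrightarrow> \<bar>f n x\<bar> \<le> M n" "summable M"
  shows "continuous_on A (\<lambda>x. \<Sum>n. f n x)"
  by (rule uniform_limit_theorem[OF _ Weierstrass_m_test[of A f M]])
    (use assms in \<open>auto intro!: always_eventually continuous_on_sum\<close>)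

lemma has_integral_suminf_mult:
  fixes f :: "nat \<Rightarrow> real \<Rightarrow> real"
  assumes f: "\<And>n. continuous_on {a..b} (f n)" and M: "\<And>n x. x \<in> {a..b} \<Longrightarrow> \<bar>f n x\<bar> \<le> M n" "summable M"
    and w: "continuous_on {a..b} w"
    and I: "\<And>n. ((\<lambda>x. f n x * w x) has_integral I n) {a..b}" "I sums J"
  shows "((\<lambda>x. (\<Sum>n. f n x) * w x) has_integral J) {a..b}"
proof -
  have ul: "uniform_limit {a..b} (\<lambda>n x. (\<Sum>i<n. f i x) * w x) (\<lambda>x. (\<Sum>n. f n x) * w x) sequentially"
  proof (rule uniform_lim_mult[OF Weierstrass_m_test[of _ f M] uniform_limit_const])
    show "bounded ((\<lambda>x. \<Sum>n. f n x) ` {a..b})"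
      by (intro compact_imp_bounded compact_continuous_image continuous_on_suminf[of _ f M] f M compact_Icc)
    show "bounded (w ` {a..b})"
      by (intro compact_imp_bounded compact_continuous_image w compact_Icc)
  qed (use M in auto)
  obtain I' J' where 1: "\<And>n. ((\<lambda>x. (\<Sum>i<n. f i x) * w x) has_integral I' n) {a..b}"
    "((\<lambda>x. (\<Sum>n. f n x) * w x) has_integral J') {a..b}" "I' \<longlonglongrightarrow> J'"
    by (rule uniform_limit_integral[OF ul]) (auto intro!: continuous_intros f w)
  have "((\<lambda>x. (\<Sum>i<n. f i x) * w x) has_integral (\<Sum>i<n. I i)) {a..b}" for n
    unfolding sum_distrib_right by (intro has_integral_sum I) auto
  then have "I' n = (\<Sum>i<n. I i)" for n
    using 1(1) has_integral_unique by blast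
  then have "I' = (\<lambda>n. \<Sum>i<n. I i)" by (intro ext)
  then have "I sums J'" using 1(3) by (simp add: sums_def)
  then show ?thesis using 1(2) I(2) sums_unique2 by blast
qed

text \<open>Weakening \<open>k^3\<close> to \<open>k\<close> reaches the majorant whose summability
  follows from Bessel's inequality.\<close>

lemma fourier_term_bound:
  fixes c b :: real
  assumes "\<bar>b\<bar> \<le> 1"
  shows "\<bar>c / real (Suc n) ^ 3 * b\<bar> \<le> \<bar>c\<bar> / real (Suc n)"
proof -
  have "\<bar>c\<bar> / real (Suc n) ^ 3 * \<bar>b\<bar> \<le> \<bar>c\<bar> / real (Suc n) ^ 3 * 1"
    using assms by (intro mult_left_mono) auto
  also have "\<dots> \<le> \<bar>c\<bar> / real (Suc n) ^ 1"
    unfolding mult_1_right by (intro divide_left_mono power_increasing) auto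
  finally show ?thesis by (simp add: abs_mult)
qed

lemma sums_single': "(\<lambda>n. if n = m then c else (0::real)) sums c"
  using sums_single[of m "\<lambda>_. c"] by simp

lemma has_integral_cos_sin_0: "((\<lambda>x. sin (real k * x) * cos (real j * x)) has_integral 0) {-pi..pi}"
  "((\<lambda>x. cos (real j * x) * sin (real k * x)) has_integral 0) {-pi..pi}"
proof -
  have "(\<lambda>x. sin (real k * x) * cos (real j * x)) integrable_on {-pi..pi}"
    by (intro integrable_continuous_real continuous_intros)
  moreover have "integral {-pi..pi} (\<lambda>x. sin (real k * x) * cos (real j * x)) = 0"
    by (rule integral_odd_eq_0) simp
  ultimately show "((\<lambda>x. sin (real k * x) * cos (real j * x)) has_integral 0) {-pi..pi}"
    by (metis integrable_integral)
  then show "((\<lambda>x. cos (real j * x) * sin (real k * x)) has_integral 0) {-pi..pi}"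
    by (simp only: mult.commute)
qed

lemma periodic_data_summable:
  assumes "periodic_data g g1 g2 g3"
  shows "summable (\<lambda>n. \<bar>fc1 g3 (Suc n)\<bar> / real (Suc n))" "summable (\<lambda>n. \<bar>fc2 g3 (Suc n)\<bar> / real (Suc n))"
proof -
  have "g3 absolutely_integrable_on {-pi..pi}" "(\<lambda>x. (g3 x)\<^sup>2) integrable_on {-pi..pi}"
    using assms unfolding periodic_data_def by blast+
  then show "summable (\<lambda>n. \<bar>fc1 g3 (Suc n)\<bar> / real (Suc n))" "summable (\<lambda>n. \<bar>fc2 g3 (Suc n)\<bar> / real (Suc n))"
    by (rule summable_fourier_coeffs_div)+
qed

text \<open>The defect \<open>d\<close> between \<open>g\<close> and the series is continuous, and
  by orthogonality all its Fourier coefficients vanish, so completeness gives \<open>d = 0\<close>;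
  no pointwise convergence theorem enters. The sine series carries a minus sign because
  \<open>fc1 g3 k\<close> is \<open>- (k^3)\<close> times the sine coefficient of
  \<open>g\<close>.\<close>

lemma periodic_data_fourier_series:
  assumes P: "periodic_data g g1 g2 g3" and x: "x \<in> {-pi..pi}"
  shows "g x = mean0 g + (\<Sum>n. fc2 g3 (Suc n) / real (Suc n) ^ 3 * cos (real (Suc n) * x))
    - (\<Sum>n. fc1 g3 (Suc n) / real (Suc n) ^ 3 * sin (real (Suc n) * x))"
proof -
  have cg: "continuous_on {-pi..pi} g"
    using P unfolding periodic_data_def by (intro DERIV_continuous_on) blast
  note sm = periodic_data_summable[OF P]
  define c where "c n x = fc2 g3 (Suc n) / real (Suc n) ^ 3 * cos (real (Suc n) * x)" for n x
  define s where "s n x = fc1 g3 (Suc n) / real (Suc n) ^ 3 * sin (real (Suc n) * x)" for n x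
  have cc: "continuous_on {-pi..pi} (c n)" and cs: "continuous_on {-pi..pi} (s n)" for n
    unfolding c_def s_def by (intro continuous_intros)+
  have bc: "\<bar>c n x\<bar> \<le> \<bar>fc2 g3 (Suc n)\<bar> / real (Suc n)" and bs: "\<bar>s n x\<bar> \<le> \<bar>fc1 g3 (Suc n)\<bar> / real (Suc n)" for n x
    unfolding c_def s_def by (rule fourier_term_bound, simp)+
  define d where "d x = g x - (mean0 g + (\<Sum>n. c n x) - (\<Sum>n. s n x))" for x
  have cd: "continuous_on {-pi..pi} d"
    unfolding d_def
    by (intro continuous_intros cg continuous_on_suminf[OF cc bc sm(2)] continuous_on_suminf[OF cs bs sm(1)])
  have d0: "integral {-pi..pi} (\<lambda>x. d x * w x) = 0"
    if w: "continuous_on {-pi..pi} w"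
      and Ic: "\<And>n. ((\<lambda>x. c n x * w x) has_integral Ic n) {-pi..pi}" "Ic sums Jc"
      and Is: "\<And>n. ((\<lambda>x. s n x * w x) has_integral Is n) {-pi..pi}" "Is sums Js"
      and J: "integral {-pi..pi} (\<lambda>x. g x * w x) = mean0 g * integral {-pi..pi} w + Jc - Js"
    for w Ic Jc Is Js
  proof -
    have "((\<lambda>x. g x * w x - (mean0 g * w x + (\<Sum>n. c n x) * w x - (\<Sum>n. s n x) * w x)) has_integral
       (integral {-pi..pi} (\<lambda>x. g x * w x) - (mean0 g * integral {-pi..pi} w + Jc - Js))) {-pi..pi}"
      by (intro has_integral_diff has_integral_add has_integral_mult_right integrable_integral
        integrable_continuous_real continuous_intros cg w
        has_integral_suminf_mult[OF cc bc sm(2) w Ic] has_integral_suminf_mult[OF cs bs sm(1) w Is])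
    then show ?thesis
      by (auto simp: d_def J algebra_simps dest!: integral_unique)
  qed
  have "d x = 0"
  proof (rule eq_0_if_fourier_coeffs_0[OF cd _ _ x])
    fix j :: nat
    show "integral {-pi..pi} (\<lambda>x. d x * cos (real j * x)) = 0"
    proof (rule d0)
      show "continuous_on {-pi..pi} (\<lambda>x. cos (real j * x))" by (intro continuous_intros)
      fix n
      show "((\<lambda>x. c n x * cos (real j * x)) has_integral
          (fc2 g3 (Suc n) / real (Suc n) ^ 3 * (if Suc n = j then pi else 0))) {-pi..pi}"
        unfolding c_def mult.assoc by (intro has_integral_mult_right has_integral_cos_cos) simp
      show "((\<lambda>x. s n x * cos (real j * x)) has_integral 0) {-pi..pi}"
        unfolding s_def mult.assoc
        by (rule has_integral_eq_rhs, rule has_integral_mult_right, rule has_integral_cos_sin_0(1)) simp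
    next
      \<comment> \<open>The series starts at frequency 1, so for \<open>j = 0\<close> it contributes
        nothing and \<open>mean0 g\<close> accounts for the whole moment.\<close>
      let ?J = "if j = 0 then 0 else fc2 g3 j / real j ^ 3 * pi"
      show "(\<lambda>n. fc2 g3 (Suc n) / real (Suc n) ^ 3 * (if Suc n = j then pi else 0)) sums ?J"
      proof (cases j)
        case (Suc m)
        have "(\<lambda>n. fc2 g3 (Suc n) / real (Suc n) ^ 3 * (if Suc n = j then pi else 0))
            = (\<lambda>n. if n = m then fc2 g3 j / real j ^ 3 * pi else 0)"
          using Suc by auto
        then show ?thesis using Suc sums_single'[of m "fc2 g3 j / real j ^ 3 * pi"] by simp
      qed simp
      show "(\<lambda>n. 0::real) sums 0" by simp
      show "integral {-pi..pi} (\<lambda>x. g x * cos (real j * x)) =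
          mean0 g * integral {-pi..pi} (\<lambda>x. cos (real j * x)) + ?J - 0"
        using has_integral_cos_int[of "int j"] periodic_data_fourier_coeffs(1)[OF P, of j]
        by (auto simp: mean0_def fc2_def dest!: integral_unique)
    qed
    show "integral {-pi..pi} (\<lambda>x. d x * sin (real j * x)) = 0"
    proof (rule d0)
      show "continuous_on {-pi..pi} (\<lambda>x. sin (real j * x))" by (intro continuous_intros)
      fix n
      show "((\<lambda>x. s n x * sin (real j * x)) has_integral
          (fc1 g3 (Suc n) / real (Suc n) ^ 3 * (if Suc n = j then pi else 0))) {-pi..pi}"
        unfolding s_def mult.assoc by (intro has_integral_mult_right has_integral_sin_sin) simp
      show "((\<lambda>x. c n x * sin (real j * x)) has_integral 0) {-pi..pi}"
        unfolding c_def mult.assoc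
        by (rule has_integral_eq_rhs, rule has_integral_mult_right, rule has_integral_cos_sin_0(2)) simp
    next
      let ?J = "if j = 0 then 0 else fc1 g3 j / real j ^ 3 * pi"
      show "(\<lambda>n. fc1 g3 (Suc n) / real (Suc n) ^ 3 * (if Suc n = j then pi else 0)) sums ?J"
      proof (cases j)
        case (Suc m)
        have "(\<lambda>n. fc1 g3 (Suc n) / real (Suc n) ^ 3 * (if Suc n = j then pi else 0))
            = (\<lambda>n. if n = m then fc1 g3 j / real j ^ 3 * pi else 0)"
          using Suc by auto
        then show ?thesis using Suc sums_single'[of m "fc1 g3 j / real j ^ 3 * pi"] by simp
      qed simp
      show "(\<lambda>n. 0::real) sums 0" by simp
      have "integral {-pi..pi} (\<lambda>x. sin (real j * x)) = 0"
        by (rule integral_odd_eq_0) simp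
      then show "integral {-pi..pi} (\<lambda>x. g x * sin (real j * x)) =
          mean0 g * integral {-pi..pi} (\<lambda>x. sin (real j * x)) + 0 - ?J"
        using periodic_data_fourier_coeffs(2)[OF P, of j] by (auto simp: fc1_def)
    qed
  qed
  then show ?thesis by (simp add: d_def c_def s_def)
qed

subsection \<open>Trigonometric series with time-dependent weights\<close>

text \<open>The phases \<open>\<theta> = 0\<close> and \<open>\<theta> = pi/2\<close> give cosine and sine series; differentiation in \<open>x\<close> shifts the
  phase by \<open>- pi/2\<close>.\<close>

definition modes :: "(nat \<Rightarrow> real \<Rightarrow> real) \<Rightarrow> (nat \<Rightarrow> real) \<Rightarrow> real \<Rightarrow> real \<Rightarrow> real \<Rightarrow> real" where
  "modes w \<beta> \<theta> x t = (\<Sum>n. w n t * \<beta> n * cos (real (Suc n) * x - \<theta>))"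

lemma modes_term_bound:
  assumes "\<bar>w n t\<bar> \<le> 1"
  shows "\<bar>w n t * \<beta> n * cos y\<bar> \<le> \<bar>\<beta> n :: real\<bar>"
proof -
  have "\<bar>w n t\<bar> * \<bar>\<beta> n\<bar> * \<bar>cos y\<bar> \<le> 1 * \<bar>\<beta> n\<bar> * 1"
    using assms by (intro mult_mono) auto
  then show ?thesis by (simp add: abs_mult)
qed

lemma summable_modes:
  assumes "summable (\<lambda>n. \<bar>\<beta> n\<bar>)" "\<And>n. \<bar>w n t\<bar> \<le> 1"
  shows "summable (\<lambda>n. w n t * \<beta> n * cos (real (Suc n) * x - \<theta>))"
  by (rule summable_comparison_test'[OF assms(1)]) (simp only: real_norm_def modes_term_bound assms(2))

lemma continuous_on_modes:
  assumes \<beta>: "summable (\<lambda>n. \<bar>\<beta> n\<bar>)" and w: "\<And>n t. t \<in> I \<Longrightarrow> \<bar>w n t\<bar> \<le> 1"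
    and cw: "\<And>n. continuous_on I (w n)"
  shows "continuous_on (UNIV \<times> I) (\<lambda>(x, t). modes w \<beta> \<theta> x t)"
  unfolding modes_def case_prod_unfold
proof (rule continuous_on_suminf[OF _ _ \<beta>])
  fix n
  have "continuous_on (UNIV \<times> I) (\<lambda>p. w n (snd p))"
    by (rule continuous_on_compose2[OF cw]) (auto intro!: continuous_intros)
  then show "continuous_on (UNIV \<times> I) (\<lambda>p. w n (snd p) * \<beta> n * cos (real (Suc n) * fst p - \<theta>))"
    by (intro continuous_intros)
  fix p :: "real \<times> real" assume "p \<in> UNIV \<times> I"
  then show "\<bar>w n (snd p) * \<beta> n * cos (real (Suc n) * fst p - \<theta>)\<bar> \<le> \<bar>\<beta> n\<bar>"
    by (intro modes_term_bound w) auto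
qed

text \<open>The set \<open>S\<close> is a parameter because the majorant may hold only on part of
  the line: derivatives in \<open>x\<close> use \<open>UNIV\<close>, but the bound for
  \<open>decay\<close> requires \<open>t \<ge> 0\<close>, so derivatives in \<open>t\<close> use
  \<open>{0..}\<close> at its interior points.\<close>

lemma DERIV_suminf:
  fixes f f' :: "nat \<Rightarrow> real \<Rightarrow> real"
  assumes S: "convex S" "x \<in> interior S"
    and d: "\<And>n y. y \<in> S \<Longrightarrow> (f n has_real_derivative f' n y) (at y)"
    and M: "\<And>n y. y \<in> S \<Longrightarrow> \<bar>f' n y\<bar> \<le> M n" "summable M"
    and f: "summable (\<lambda>n. f n x)"
  shows "((\<lambda>y. \<Sum>n. f n y) has_real_derivative (\<Sum>n. f' n x)) (at x)"
proof (rule has_field_derivative_series'(2)[of S f f' x x])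
  show "uniformly_convergent_on S (\<lambda>n y. \<Sum>i<n. f' i y)"
    using M by (intro Weierstrass_m_test') auto
  show "x \<in> S" using S interior_subset by blast
  show "(f n has_field_derivative f' n y) (at y within S)" if "y \<in> S" for n y
    by (rule has_field_derivative_at_within[OF d[OF that]])
qed (fact S f)+

lemma summable_abs_divide_Suc:
  assumes "summable (\<lambda>n. \<bar>\<beta> n * real (Suc n)\<bar>)"
  shows "summable (\<lambda>n. \<bar>\<beta> n\<bar>)"
proof (rule summable_comparison_test'[OF assms])
  fix n
  have "\<bar>\<beta> n\<bar> * 1 \<le> \<bar>\<beta> n\<bar> * real (Suc n)" by (intro mult_left_mono) auto
  then show "norm \<bar>\<beta> n\<bar> \<le> \<bar>\<beta> n * real (Suc n)\<bar>" by (simp add: abs_mult)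
qed

lemma modes_DERIV_x:
  assumes \<beta>: "summable (\<lambda>n. \<bar>\<beta> n * real (Suc n)\<bar>)" and w: "\<And>n. \<bar>w n t\<bar> \<le> 1"
  shows "((\<lambda>y. modes w \<beta> \<theta> y t) has_real_derivative modes w (\<lambda>n. \<beta> n * real (Suc n)) (\<theta> - pi/2) x t) (at x)"
  unfolding modes_def
proof (rule DERIV_suminf[where S = UNIV, OF _ _ _ _ \<beta>])
  fix n y
  have "cos (real (Suc n) * y - (\<theta> - pi/2)) = - sin (real (Suc n) * y - \<theta>)"
    by (simp add: cos_diff sin_diff algebra_simps cos_add sin_add)
  then show "((\<lambda>y. w n t * \<beta> n * cos (real (Suc n) * y - \<theta>)) has_real_derivative
      w n t * (\<beta> n * real (Suc n)) * cos (real (Suc n) * y - (\<theta> - pi/2))) (at y)"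
    by (auto intro!: derivative_eq_intros)
  show "\<bar>w n t * (\<beta> n * real (Suc n)) * cos (real (Suc n) * y - (\<theta> - pi/2))\<bar> \<le> \<bar>\<beta> n * real (Suc n)\<bar>"
    by (rule modes_term_bound[where w=w, OF w])
qed (simp_all only: convex_UNIV interior_UNIV UNIV_I summable_modes[where w=w and t=t, OF summable_abs_divide_Suc[OF \<beta>] w])

text \<open>This closes the second derivative: the phase is left as
  \<open>\<theta> - pi/2 - pi/2\<close> to match two applications of
  \<open>modes_DERIV_x\<close>.\<close>

lemma modes_shift:
  assumes \<beta>: "summable (\<lambda>n. \<bar>\<beta> n\<bar>)" and w: "\<And>n. \<bar>w n t\<bar> \<le> 1"
  shows "modes w \<beta> (\<theta> - pi/2 - pi/2) x t = - modes w \<beta> \<theta> x t"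
proof -
  have "cos (real (Suc n) * x - (\<theta> - pi/2 - pi/2)) = - cos (real (Suc n) * x - \<theta>)" for n
    by (simp add: cos_diff sin_diff algebra_simps cos_add sin_add)
  then show ?thesis
    unfolding modes_def using suminf_minus[OF summable_modes[where w=w and t=t, OF assms]] by simp
qed

lemma modes_periodic: "modes w \<beta> \<theta> (-pi) t = modes w \<beta> \<theta> pi t"
  unfolding modes_def cos_diff mult_minus_right cos_minus sin_minus sin_nat_pi by simp

lemma modes_even: "modes w \<beta> 0 (-x) t = modes w \<beta> 0 x t"
  unfolding modes_def by simp

lemma modes_odd:
  assumes \<beta>: "summable (\<lambda>n. \<bar>\<beta> n\<bar>)" and w: "\<And>n. \<bar>w n t\<bar> \<le> 1"
  shows "modes w \<beta> (pi/2) (-x) t = - modes w \<beta> (pi/2) x t"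
  unfolding modes_def using suminf_minus[OF summable_modes[where w=w and t=t and x=x and \<theta>="pi/2", OF assms]]
  by (simp add: cos_diff)

section \<open>Exponential weights in time and regularity of the resulting series\<close>

definition decay :: "real \<Rightarrow> nat \<Rightarrow> real \<Rightarrow> real" where
  "decay \<mu> n t = exp (- (\<mu> * real (Suc n) ^ 2 * t))"

text \<open>Divided by its value at \<open>T\<close>, this weight rises from 0 at
  \<open>t = 0\<close> to 1 at \<open>t = T\<close>, so it interpolates between the initial and the
  final data in each mode.\<close>

definition growth :: "real \<Rightarrow> nat \<Rightarrow> real \<Rightarrow> real" where
  "growth \<mu> n t = 1 - decay \<mu> n t"

lemma decay_bound: "\<mu> > 0 \<Longrightarrow> t \<ge> 0 \<Longrightarrow> \<bar>decay \<mu> n t\<bar> \<le> 1"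
  by (simp add: decay_def)

lemma growth_bound: "\<mu> > 0 \<Longrightarrow> t \<ge> 0 \<Longrightarrow> \<bar>growth \<mu> n t\<bar> \<le> 1"
  by (simp add: decay_def growth_def)

lemma continuous_on_decay: "continuous_on A (decay \<mu> n)"
  unfolding decay_def by (intro continuous_intros)

lemma continuous_on_growth: "continuous_on A (growth \<mu> n)"
  unfolding growth_def by (intro continuous_intros continuous_on_decay)

lemma modes_DERIV_t:
  assumes \<mu>: "\<mu> > 0" and \<beta>: "summable (\<lambda>n. \<bar>\<beta> n\<bar>)" "summable (\<lambda>n. \<bar>\<mu> * real (Suc n) ^ 2 * \<beta> n\<bar>)"
    and t: "t > 0"
  shows "((\<lambda>s. modes (growth \<mu>) \<beta> \<theta> x s) has_real_derivative
    modes (decay \<mu>) (\<lambda>n. \<mu> * real (Suc n) ^ 2 * \<beta> n) \<theta> x t) (at t)"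
  unfolding modes_def
proof (rule DERIV_suminf[where S = "{0..}", OF _ _ _ _ \<beta>(2)])
  fix n and s :: real
  show "((\<lambda>s. growth \<mu> n s * \<beta> n * cos (real (Suc n) * x - \<theta>)) has_real_derivative
      decay \<mu> n s * (\<mu> * real (Suc n) ^ 2 * \<beta> n) * cos (real (Suc n) * x - \<theta>)) (at s)"
    unfolding growth_def decay_def by (auto intro!: derivative_eq_intros)
  assume "s \<in> {0..}"
  then show "\<bar>decay \<mu> n s * (\<mu> * real (Suc n) ^ 2 * \<beta> n) * cos (real (Suc n) * x - \<theta>)\<bar> \<le> \<bar>\<mu> * real (Suc n) ^ 2 * \<beta> n\<bar>"
    using \<mu> by (intro modes_term_bound decay_bound) auto
next
  show "summable (\<lambda>n. growth \<mu> n t * \<beta> n * cos (real (Suc n) * x - \<theta>))"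
    using t by (intro summable_modes \<beta> growth_bound \<mu>) auto
qed (use t in auto)

lemma growth_pos: "\<mu> > 0 \<Longrightarrow> T > 0 \<Longrightarrow> growth \<mu> n T > 0"
  by (simp add: growth_def decay_def)

lemma growth_mono: "\<mu> > 0 \<Longrightarrow> T > 0 \<Longrightarrow> growth \<mu> 0 T \<le> growth \<mu> n T"
  by (simp add: growth_def decay_def)

text \<open>The denominators cannot approach 0: for \<open>T > 0\<close> they are smallest at
  \<open>n = 0\<close>, so \<open>1 / growth \<mu> 0 T\<close> is a uniform bound for their
  reciprocals.\<close>

lemma summable_divide_growth:
  assumes \<mu>: "\<mu> > 0" "T > 0" and c: "summable (\<lambda>n. \<bar>c n\<bar> / real (Suc n))"
  shows "summable (\<lambda>n. \<bar>c n / (growth \<mu> n T * real (Suc n))\<bar>)"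
proof (rule summable_comparison_test')
  show "summable (\<lambda>n. \<bar>c n\<bar> / real (Suc n) * (1 / growth \<mu> 0 T))"
    by (intro summable_mult2 c)
  fix n
  have "\<bar>c n\<bar> / real (Suc n) * (1 / growth \<mu> n T) \<le> \<bar>c n\<bar> / real (Suc n) * (1 / growth \<mu> 0 T)"
    using growth_pos[OF \<mu>] growth_mono[OF \<mu>] by (intro mult_left_mono divide_left_mono) auto
  then show "norm \<bar>c n / (growth \<mu> n T * real (Suc n))\<bar> \<le> \<bar>c n\<bar> / real (Suc n) * (1 / growth \<mu> 0 T)"
    using growth_pos[OF \<mu>, of n] by (simp add: abs_mult mult.commute)
qed

text \<open>Normalising by the coefficients \<open>\<gamma>\<close> of the second derivative makes
  one summability assumption serve \<open>u\<close>, \<open>ux\<close>, \<open>uxx\<close> and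
  \<open>ut\<close>. The last claim is the heart of the formula: \<open>decay + growth = 1\<close>,
  so the time dependence cancels in \<open>ut - \<mu> * uxx\<close> and a source depending on
  \<open>x\<close> alone remains.\<close>

lemma modes_regular:
  fixes \<gamma> :: "nat \<Rightarrow> real" and \<theta> :: real
  assumes \<mu>: "\<mu> > 0" and \<gamma>: "summable (\<lambda>n. \<bar>\<gamma> n\<bar>)"
  defines "u \<equiv> modes (growth \<mu>) (\<lambda>n. \<gamma> n / real (Suc n) / real (Suc n)) \<theta>"
    and "ux \<equiv> modes (growth \<mu>) (\<lambda>n. \<gamma> n / real (Suc n)) (\<theta> - pi/2)"
    and "uxx \<equiv> (\<lambda>x t. - modes (growth \<mu>) \<gamma> \<theta> x t)"
    and "ut \<equiv> (\<lambda>x t. \<mu> * modes (decay \<mu>) \<gamma> \<theta> x t)"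
  shows "continuous_on (UNIV \<times> {0..}) (\<lambda>(x, t). u x t)"
    and "continuous_on (UNIV \<times> {0..}) (\<lambda>(x, t). ux x t)"
    and "continuous_on (UNIV \<times> {0..}) (\<lambda>(x, t). uxx x t)"
    and "continuous_on (UNIV \<times> {0..}) (\<lambda>(x, t). ut x t)"
    and "\<And>x t. t \<ge> 0 \<Longrightarrow> ((\<lambda>y. u y t) has_real_derivative ux x t) (at x)"
    and "\<And>x t. t \<ge> 0 \<Longrightarrow> ((\<lambda>y. ux y t) has_real_derivative uxx x t) (at x)"
    and "\<And>x t. t > 0 \<Longrightarrow> ((\<lambda>s. u x s) has_real_derivative ut x t) (at t)"
    and "\<And>x t. t \<ge> 0 \<Longrightarrow> ut x t - \<mu> * uxx x t = \<mu> * modes (\<lambda>_ _. 1) \<gamma> \<theta> x t"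
proof -
  have \<gamma>1: "summable (\<lambda>n. \<bar>\<gamma> n / real (Suc n)\<bar>)"
    by (rule summable_abs_divide_Suc) (simp add: \<gamma>)
  have \<gamma>2: "summable (\<lambda>n. \<bar>\<gamma> n / real (Suc n) / real (Suc n)\<bar>)"
    by (rule summable_abs_divide_Suc) (simp add: \<gamma>1[simplified])
  have gb: "\<bar>growth \<mu> n t\<bar> \<le> 1" and db: "\<bar>decay \<mu> n t\<bar> \<le> 1" if "t \<ge> 0" for n t
    using growth_bound[OF \<mu> that] decay_bound[OF \<mu> that] by auto
  show "continuous_on (UNIV \<times> {0..}) (\<lambda>(x, t). u x t)"
    unfolding u_def by (rule continuous_on_modes[OF \<gamma>2]) (auto intro: gb continuous_on_growth)
  show "continuous_on (UNIV \<times> {0..}) (\<lambda>(x, t). ux x t)"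
    unfolding ux_def by (rule continuous_on_modes[OF \<gamma>1]) (auto intro: gb continuous_on_growth)
  have "continuous_on (UNIV \<times> {0..}) (\<lambda>(x, t). modes (growth \<mu>) \<gamma> \<theta> x t)"
    by (rule continuous_on_modes[OF \<gamma>]) (auto intro: gb continuous_on_growth)
  then show "continuous_on (UNIV \<times> {0..}) (\<lambda>(x, t). uxx x t)"
    unfolding uxx_def case_prod_unfold by (rule continuous_on_minus)
  have "continuous_on (UNIV \<times> {0..}) (\<lambda>(x, t). modes (decay \<mu>) \<gamma> \<theta> x t)"
    by (rule continuous_on_modes[OF \<gamma>]) (auto intro: db continuous_on_decay)
  then show "continuous_on (UNIV \<times> {0..}) (\<lambda>(x, t). ut x t)"
    unfolding ut_def case_prod_unfold by (intro continuous_on_mult_left)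
  fix x t :: real
  show "((\<lambda>y. u y t) has_real_derivative ux x t) (at x)" if "t \<ge> 0"
    using modes_DERIV_x[where w = "growth \<mu>" and t = t and \<beta> = "\<lambda>n. \<gamma> n / real (Suc n) / real (Suc n)" and x = x and \<theta> = \<theta>]
      \<gamma>1 gb[OF that] unfolding u_def ux_def by simp
  show "((\<lambda>y. ux y t) has_real_derivative uxx x t) (at x)" if "t \<ge> 0"
    using modes_DERIV_x[where w = "growth \<mu>" and t = t and \<beta> = "\<lambda>n. \<gamma> n / real (Suc n)" and x = x and \<theta> = "\<theta> - pi/2"]
      \<gamma> gb[OF that] modes_shift[where w = "growth \<mu>" and t = t and \<beta> = \<gamma> and x = x and \<theta> = \<theta>]
    unfolding ux_def uxx_def by simp
  show "((\<lambda>s. u x s) has_real_derivative ut x t) (at t)" if "t > 0"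
  proof -
    have p: "\<mu> * real (Suc n) ^ 2 * (\<gamma> n / real (Suc n) / real (Suc n)) = \<mu> * \<gamma> n" for n
      by (simp add: power2_eq_square)
    then have *: "(\<lambda>n. \<mu> * real (Suc n) ^ 2 * (\<gamma> n / real (Suc n) / real (Suc n))) = (\<lambda>n. \<mu> * \<gamma> n)"
      by (intro ext)
    have "modes (decay \<mu>) (\<lambda>n. \<mu> * \<gamma> n) \<theta> x t = \<mu> * modes (decay \<mu>) \<gamma> \<theta> x t"
      unfolding modes_def
      using suminf_mult[OF summable_modes[where w = "decay \<mu>" and t = t, OF \<gamma>], of \<mu> x \<theta>] db[of t] that
      by (simp add: mult_ac)
    moreover have "((\<lambda>s. u x s) has_real_derivative modes (decay \<mu>) (\<lambda>n. \<mu> * \<gamma> n) \<theta> x t) (at t)"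
      unfolding u_def *[symmetric]
      by (rule modes_DERIV_t[OF \<mu> \<gamma>2 _ that]) (unfold p, use \<gamma> in \<open>simp add: abs_mult summable_mult\<close>)
    ultimately show ?thesis unfolding ut_def by simp
  qed
  show "ut x t - \<mu> * uxx x t = \<mu> * modes (\<lambda>_ _. 1) \<gamma> \<theta> x t" if "t \<ge> 0"
  proof -
    have "modes (decay \<mu>) \<gamma> \<theta> x t + modes (growth \<mu>) \<gamma> \<theta> x t = modes (\<lambda>_ _. 1) \<gamma> \<theta> x t"
      unfolding modes_def
      by (subst suminf_add[OF summable_modes[where w = "decay \<mu>" and t = t, OF \<gamma> db[OF that]]
            summable_modes[where w = "growth \<mu>" and t = t, OF \<gamma> gb[OF that]]])
        (simp add: growth_def algebra_simps)
    then show ?thesis unfolding ut_def uxx_def by (simp add: algebra_simps flip: distrib_left)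
  qed
qed

section \<open>The closed formulas for \<open>u\<close> and \<open>f\<close> as trigonometric
  series\<close>

lemma sol_u_eq_modes:
  "sol_u T \<epsilon> \<phi> \<psi> \<phi>3 \<psi>3 x t = \<phi> x + t / T * (mean0 \<psi> - mean0 \<phi>)
    - modes (growth (1 - \<epsilon>)) (\<lambda>n. (fc2 \<phi>3 (Suc n) - fc2 \<psi>3 (Suc n)) / (growth (1 - \<epsilon>) n T * real (Suc n)) / real (Suc n) / real (Suc n)) 0 x t
    + modes (growth (1 + \<epsilon>)) (\<lambda>n. (fc1 \<phi>3 (Suc n) - fc1 \<psi>3 (Suc n)) / (growth (1 + \<epsilon>) n T * real (Suc n)) / real (Suc n) / real (Suc n)) (pi/2) x t"
proof -
  have "cos (y - pi/2) = sin y" for y :: real by (simp add: cos_diff)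
  then show ?thesis
    unfolding sol_u_def modes_def growth_def decay_def Let_def minus_mult_left[symmetric] mult_minus_left
    by (simp add: power3_eq_cube power2_eq_square mult.assoc)
qed

text \<open>The weight is constantly 1, so \<open>t\<close> on the right is a dummy; it stays free
  to be matched with the time at which the equation is checked. Summability allows the factors
  \<open>1 - \<epsilon>\<close> and \<open>1 + \<epsilon>\<close> to pass through the sums.\<close>

lemma sol_f_eq_modes:
  assumes "summable (\<lambda>n. \<bar>(fc2 \<phi>3 (Suc n) - fc2 \<psi>3 (Suc n)) / (growth (1 - \<epsilon>) n T * real (Suc n))\<bar>)"
    and "summable (\<lambda>n. \<bar>(fc1 \<phi>3 (Suc n) - fc1 \<psi>3 (Suc n)) / (growth (1 + \<epsilon>) n T * real (Suc n))\<bar>)"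
  shows "sol_f T \<epsilon> \<phi> \<psi> \<phi>2 \<phi>3 \<psi>3 x = - \<phi>2 x + \<epsilon> * \<phi>2 (- x) + (mean0 \<psi> - mean0 \<phi>) / T
    - (1 - \<epsilon>) * modes (\<lambda>_ _. 1) (\<lambda>n. (fc2 \<phi>3 (Suc n) - fc2 \<psi>3 (Suc n)) / (growth (1 - \<epsilon>) n T * real (Suc n))) 0 x t
    + (1 + \<epsilon>) * modes (\<lambda>_ _. 1) (\<lambda>n. (fc1 \<phi>3 (Suc n) - fc1 \<psi>3 (Suc n)) / (growth (1 + \<epsilon>) n T * real (Suc n))) (pi/2) x t"
proof -
  have *: "cos (y - pi/2) = sin y" for y :: real by (simp add: cos_diff)
  have 1: "(1 - \<epsilon>) * modes (\<lambda>_ _. 1) (\<lambda>n. (fc2 \<phi>3 (Suc n) - fc2 \<psi>3 (Suc n)) / (growth (1 - \<epsilon>) n T * real (Suc n))) 0 x t =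
    (\<Sum>n. (1 - \<epsilon>) * (1 * ((fc2 \<phi>3 (Suc n) - fc2 \<psi>3 (Suc n)) / (growth (1 - \<epsilon>) n T * real (Suc n))) * cos (real (Suc n) * x - 0)))"
    unfolding modes_def
    by (rule suminf_mult[symmetric, OF summable_modes[where w = "\<lambda>_ _. 1", OF assms(1)]]) simp
  have 2: "(1 + \<epsilon>) * modes (\<lambda>_ _. 1) (\<lambda>n. (fc1 \<phi>3 (Suc n) - fc1 \<psi>3 (Suc n)) / (growth (1 + \<epsilon>) n T * real (Suc n))) (pi/2) x t =
    (\<Sum>n. (1 + \<epsilon>) * (1 * ((fc1 \<phi>3 (Suc n) - fc1 \<psi>3 (Suc n)) / (growth (1 + \<epsilon>) n T * real (Suc n))) * cos (real (Suc n) * x - pi/2)))"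
    unfolding modes_def
    by (rule suminf_mult[symmetric, OF summable_modes[where w = "\<lambda>_ _. 1", OF assms(2)]]) simp
  show ?thesis
    unfolding 1 2
    unfolding sol_f_def growth_def decay_def Let_def * minus_mult_left[symmetric] mult_minus_left
    by (simp add: mult.assoc)
qed

subsection \<open>Uniqueness\<close>

text \<open>Estimates from the equation are available only on \<open>{-r..r}\<close> with
  \<open>r < a\<close>; continuity of the indefinite integral carries them to
  \<open>r = a\<close>.\<close>

lemma integral_symmetric_eq_0_if_inner_small:
  fixes Q :: "real \<Rightarrow> real"
  assumes a: "a > 0" and Q: "continuous_on {-a..a} Q"
    and small: "\<And>e. e > 0 \<Longrightarrow> \<exists>\<delta>>0. \<forall>r. 0 < r \<longrightarrow> a - \<delta> < r \<longrightarrow> r < a \<longrightarrow> \<bar>integral {-r..r} Q\<bar> \<le> e"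
  shows "integral {-a..a} Q = 0"
proof -
  have Qi: "Q integrable_on {-a..a}" using Q by (rule integrable_continuous_real)
  define \<Phi> where "\<Phi> x = integral {-a..x} Q" for x
  have c\<Phi>: "continuous_on {-a..a} \<Phi>"
    unfolding \<Phi>_def by (rule indefinite_integral_continuous_1[OF Qi])
  have cJ: "continuous_on {0..a} (\<lambda>r. \<Phi> r - \<Phi> (-r))"
    by (intro continuous_on_diff continuous_on_compose2[OF c\<Phi>] continuous_intros) auto
  have J: "\<Phi> r - \<Phi> (-r) = integral {-r..r} Q" if "0 \<le> r" "r \<le> a" for r
    unfolding \<Phi>_def
    using Henstock_Kurzweil_Integration.integral_combine[of "-a" "-r" r Q] that
      integrable_on_subinterval[OF Qi, of "-a" r] by auto
  have "((\<lambda>r. \<Phi> r - \<Phi> (-r)) \<longlongrightarrow> \<Phi> a - \<Phi> (-a)) (at a within {0..a})"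
    using cJ a by (auto simp: continuous_on_def)
  then have lim: "((\<lambda>r. \<Phi> r - \<Phi> (-r)) \<longlongrightarrow> \<Phi> a - \<Phi> (-a)) (at a within {0<..<a})"
    by (rule tendsto_within_subset) auto
  have "((\<lambda>r. \<Phi> r - \<Phi> (-r)) \<longlongrightarrow> 0) (at a within {0<..<a})"
  proof (rule tendstoI)
    fix e :: real assume "e > 0"
    then obtain \<delta> where \<delta>: "\<delta> > 0"
      "\<And>r. 0 < r \<Longrightarrow> a - \<delta> < r \<Longrightarrow> r < a \<Longrightarrow> \<bar>integral {-r..r} Q\<bar> \<le> e / 2"
      using small[of "e / 2"] by auto
    show "\<forall>\<^sub>F r in at a within {0<..<a}. dist (\<Phi> r - \<Phi> (-r)) 0 < e"
      unfolding eventually_at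
    proof (intro exI conjI ballI impI)
      fix r assume r: "r \<in> {0<..<a}" "r \<noteq> a \<and> dist r a < \<delta>"
      then have "\<bar>integral {-r..r} Q\<bar> \<le> e / 2" using \<delta>(2)[of r] by (auto simp: dist_real_def)
      then show "dist (\<Phi> r - \<Phi> (-r)) 0 < e" using J[of r] r \<open>e > 0\<close> by auto
    qed (rule \<delta>(1))
  qed
  moreover have "at a within {0<..<a} \<noteq> bot"
    using a by (simp add: at_within_eq_bot_iff islimpt_greaterThanLessThan2 closure_greaterThanLessThan trivial_limit_within)
  ultimately have "\<Phi> a - \<Phi> (-a) = 0" using lim tendsto_unique by blast
  then show ?thesis using J[of a] a by simp
qed

lemma continuous_on_slice:
  fixes w :: "real \<Rightarrow> real \<Rightarrow> real"
  assumes "continuous_on (X \<times> Y) (\<lambda>(x,t). w x t)" "A \<subseteq> X" "s \<in> Y"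
  shows "continuous_on A (\<lambda>x. w x s)"
proof -
  have "continuous_on A (\<lambda>x. (\<lambda>(x,t). w x t) (x, s))"
    by (rule continuous_on_compose2[OF assms(1)]) (use assms in \<open>auto intro!: continuous_intros\<close>)
  then show ?thesis by simp
qed

text \<open>Names the derivatives that \<open>regular_solution\<close> hides behind an existential
  quantifier, so that the facts about two solutions can be used side by side.\<close>

locale regular_solution_derivatives =
  fixes T \<epsilon> :: real and \<phi> \<psi> :: "real \<Rightarrow> real" and u :: "real \<Rightarrow> real \<Rightarrow> real" and f :: "real \<Rightarrow> real"
    and ux uxx ut :: "real \<Rightarrow> real \<Rightarrow> real"
  assumes cont_u: "continuous_on ({-pi..pi} \<times> {0..T}) (\<lambda>(x,t). u x t)"
    and cont_f: "continuous_on {-pi..pi} f"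
    and DERIV_u_x: "\<And>x t. x \<in> {-pi..pi} \<Longrightarrow> t \<in> {0..T} \<Longrightarrow> ((\<lambda>y. u y t) has_real_derivative ux x t) (at x within {-pi..pi})"
    and cont_ux: "continuous_on ({-pi..pi} \<times> {0..T}) (\<lambda>(x,t). ux x t)"
    and DERIV_ux_x: "\<And>x t. x \<in> {-pi<..<pi} \<Longrightarrow> t \<in> {0<..<T} \<Longrightarrow> ((\<lambda>y. ux y t) has_real_derivative uxx x t) (at x)"
    and DERIV_u_t: "\<And>x t. x \<in> {-pi<..<pi} \<Longrightarrow> t \<in> {0<..<T} \<Longrightarrow> ((\<lambda>s. u x s) has_real_derivative ut x t) (at t)"
    and cont_uxx: "continuous_on ({-pi<..<pi} \<times> {0<..<T}) (\<lambda>(x,t). uxx x t)"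
    and cont_ut: "continuous_on ({-pi<..<pi} \<times> {0<..<T}) (\<lambda>(x,t). ut x t)"
    and pde: "\<And>x t. x \<in> {-pi<..<pi} \<Longrightarrow> t \<in> {0<..<T} \<Longrightarrow> ut x t - uxx x t + \<epsilon> * uxx (-x) t = f x"
    and periodic: "\<And>t. t \<in> {0..T} \<Longrightarrow> u (-pi) t = u pi t" "\<And>t. t \<in> {0..T} \<Longrightarrow> ux (-pi) t = ux pi t"
    and initial: "\<And>x. x \<in> {-pi..pi} \<Longrightarrow> u x 0 = \<phi> x"
    and final: "\<And>x. x \<in> {-pi..pi} \<Longrightarrow> u x T = \<psi> x"

lemma regular_solution_iff:
  "regular_solution T \<epsilon> \<phi> \<psi> u f \<longleftrightarrow> (\<exists>ux uxx ut. regular_solution_derivatives T \<epsilon> \<phi> \<psi> u f ux uxx ut)"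
  unfolding regular_solution_def regular_solution_derivatives_def Ball_def
  by (simp only: all_conj_distrib imp_conjR all_simps)
    (rule iffI; elim conjE exE; intro exI conjI; assumption)

text \<open>Substituting \<open>-x\<close> moves the reflection from the unknown function to the
  test function, where it is only a sign. This is how the nonlocal term enters the moment equation
  as the factor \<open>1 - \<sigma> * \<epsilon>\<close>.\<close>

lemma sign_reflected_integral:
  fixes v c :: "real \<Rightarrow> real"
  assumes "\<And>x. c (-x) = \<sigma> * c x"
  shows "integral {-r..r} (\<lambda>x. v (-x) * c x) = \<sigma> * integral {-r..r} (\<lambda>x. v x * c x)"
proof -
  have "integral {-r..r} (\<lambda>x. v (-x) * c x) = integral {-r..r} (\<lambda>x. v x * c (-x))"
    using Henstock_Kurzweil_Integration.integral_reflect_real[of r "-r" "\<lambda>x. v x * c (-x)"] by simp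
  then show ?thesis by (simp add: assms mult.left_commute)
qed

text \<open>Testing the equation against an eigenfunction \<open>c\<close> on \<open>{-r..r}\<close> with \<open>r < pi\<close>, where all
  derivatives are continuous, gives a linear ordinary differential equation for the moment of \<open>u\<close>
  up to boundary terms, which vanish uniformly in \<open>t\<close> as \<open>r\<close> tends to \<open>pi\<close>.\<close>

lemma zero_data_moment_eq_0:
  fixes c c' :: "real \<Rightarrow> real"
  assumes T: "T > 0" and R: "regular_solution T \<epsilon> (\<lambda>_. 0) (\<lambda>_. 0) u f"
    and c: "\<And>x. (c has_real_derivative c' x) (at x)"
    and c': "\<And>x. (c' has_real_derivative - \<kappa> * c x) (at x)"
    and \<sigma>: "\<And>x. c (-x) = \<sigma> * c x"
    and per: "c (-pi) = c pi" "c' (-pi) = c' pi"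
    and t: "t \<in> {0..T}"
  shows "integral {-pi..pi} (\<lambda>x. u x t * c x) = 0"
proof -
  obtain ux uxx ut where "regular_solution_derivatives T \<epsilon> (\<lambda>_. 0) (\<lambda>_. 0) u f ux uxx ut"
    using R unfolding regular_solution_iff by (elim exE) (rule that)
  then interpret regular_solution_derivatives T \<epsilon> "\<lambda>_. 0" "\<lambda>_. 0" u f ux uxx ut .
  have cc: "continuous_on S c" "continuous_on S c'" for S
    by (rule DERIV_continuous_on[OF has_field_derivative_at_within], rule c c')+
  define \<mu> where "\<mu> = (1 - \<sigma> * \<epsilon>) * \<kappa>"
  \<comment> \<open>The primitive of \<open>exp (\<mu> * s)\<close> vanishing at 0. The case
    \<open>\<mu> = 0\<close> occurs for the constant test function, where
    \<open>\<kappa> = 0\<close>.\<close>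
  define h where "h t = (if \<mu> = 0 then t else (exp (\<mu> * t) - 1) / \<mu>)" for t
  have h0: "h 0 = 0" by (simp add: h_def)
  have dh: "(h has_real_derivative exp (\<mu> * s)) (at s)" for s
    unfolding h_def by (cases "\<mu> = 0") (auto intro!: derivative_eq_intros)
  have hT: "h T \<noteq> 0" using T by (simp add: h_def)
  define A where "A r t = integral {-r..r} (\<lambda>x. u x t * c x)" for r t
  define F where "F r = integral {-r..r} (\<lambda>x. f x * c x)" for r
  \<comment> \<open>The boundary expression of Green's second identity for \<open>u\<close> and
    \<open>c\<close>; periodicity of both makes it agree at \<open>-pi\<close> and
    \<open>pi\<close>.\<close>
  define P where "P x t = ux x t * c x - u x t * c' x" for x t
  have dA: "((\<lambda>t. A r t) has_real_derivative - \<mu> * A r t + (1 - \<sigma> * \<epsilon>) * (P r t - P (-r) t) + F r) (at t)"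
    if r: "0 < r" "r < pi" and t: "t \<in> {0<..<T}" for r t
  proof -
    have sub: "{-r..r} \<subseteq> {-pi<..<pi}" "{-r..r} \<subseteq> {-pi..pi}" using r by auto
    have t': "t \<in> {0..T}" using t by auto
    have cuxt: "continuous_on {-r..r} (\<lambda>x. ux x t)" by (rule continuous_on_slice[OF cont_ux sub(2) t'])
    have cuxxt: "continuous_on {-r..r} (\<lambda>x. uxx x t)" by (rule continuous_on_slice[OF cont_uxx sub(1) t])
    have cuxxt': "continuous_on {-r..r} (\<lambda>x. uxx (-x) t)"
      by (rule continuous_on_compose2[OF cuxxt]) (auto intro!: continuous_intros)
    have cfr: "continuous_on {-r..r} f" by (rule continuous_on_subset[OF cont_f sub(2)])
    have "((\<lambda>t. integral (cbox (-r) r) (\<lambda>x. u x t * c x)) has_field_derivative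
        integral (cbox (-r) r) (\<lambda>x. ut x t * c x)) (at t within {0<..<T})"
    proof (rule leibniz_rule_field_derivative)
      fix s x assume s: "s \<in> {0<..<T}" and x: "x \<in> cbox (-r) r"
      then have "x \<in> {-pi<..<pi}" using sub by auto
      from has_field_derivative_at_within[OF DERIV_u_t[OF this s]]
      show "((\<lambda>s. u x s * c x) has_field_derivative ut x s * c x) (at s within {0<..<T})"
        by (auto intro!: derivative_eq_intros)
    next
      fix s assume "s \<in> {0<..<T}"
      then have "continuous_on {-r..r} (\<lambda>x. u x s)" by (intro continuous_on_slice[OF cont_u sub(2)]) auto
      then show "(\<lambda>x. u x s * c x) integrable_on cbox (-r) r"
        unfolding cbox_interval by (intro integrable_continuous_real continuous_intros cc)
    next
      have "continuous_on ({0<..<T} \<times> {-r..r}) (\<lambda>p. (\<lambda>(x,t). ut x t) (snd p, fst p))"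
        by (rule continuous_on_compose2[OF cont_ut]) (use sub in \<open>auto intro!: continuous_intros\<close>)
      then have "continuous_on ({0<..<T} \<times> {-r..r}) (\<lambda>p. ut (snd p) (fst p) * c (snd p))"
        by (intro continuous_intros continuous_on_compose2[OF cc(1)[of UNIV]]) auto
      then show "continuous_on ({0<..<T} \<times> cbox (-r) r) (\<lambda>(t, x). ut x t * c x)"
        by (simp add: case_prod_unfold)
    qed (use t in auto)
    then have d: "((\<lambda>t. A r t) has_real_derivative integral {-r..r} (\<lambda>x. ut x t * c x)) (at t)"
      unfolding A_def using t by (simp add: at_within_open[of t "{0<..<T}"])
    have "integral {-r..r} (\<lambda>x. ut x t * c x) = integral {-r..r} (\<lambda>x. uxx x t * c x - \<epsilon> * (uxx (-x) t * c x) + f x * c x)"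
    proof (rule Henstock_Kurzweil_Integration.integral_cong)
      fix x assume "x \<in> {-r..r}"
      then have *: "ut x t = uxx x t - \<epsilon> * uxx (-x) t + f x" using pde[of x t] sub t by force
      show "ut x t * c x = uxx x t * c x - \<epsilon> * (uxx (-x) t * c x) + f x * c x"
        unfolding * by (simp add: algebra_simps)
    qed
    also have "\<dots> = integral {-r..r} (\<lambda>x. uxx x t * c x) - \<epsilon> * integral {-r..r} (\<lambda>x. uxx (-x) t * c x) + F r"
      unfolding F_def
      by (intro integral_unique has_integral_add has_integral_diff has_integral_mult_right integrable_integral
        integrable_continuous_real continuous_intros cuxxt cuxxt' cc cfr)
    also have "integral {-r..r} (\<lambda>x. uxx (-x) t * c x) = \<sigma> * integral {-r..r} (\<lambda>x. uxx x t * c x)"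
      by (rule sign_reflected_integral[where c = c]) (rule \<sigma>)
    also have "integral {-r..r} (\<lambda>x. uxx x t * c x) = ux r t * c r - ux (-r) t * c (-r) - integral {-r..r} (\<lambda>x. ux x t * c' x)"
    proof (rule integral_by_parts_C1[OF _ _ cuxxt])
      show "((\<lambda>y. ux y t) has_real_derivative uxx x t) (at x within {-r..r})" if "x \<in> {-r..r}" for x
        by (rule has_field_derivative_at_within[OF DERIV_ux_x]) (use that sub t in auto)
    qed (use r in \<open>auto intro: cc has_field_derivative_at_within[OF c]\<close>)
    also have "integral {-r..r} (\<lambda>x. ux x t * c' x) = u r t * c' r - u (-r) t * c' (-r) - integral {-r..r} (\<lambda>x. u x t * (- \<kappa> * c x))"
    proof (rule integral_by_parts_C1[OF _ _ cuxt])
      show "((\<lambda>y. u y t) has_real_derivative ux x t) (at x within {-r..r})" if "x \<in> {-r..r}" for x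
        using DERIV_subset[OF DERIV_u_x[of x t] sub(2)] that sub t' by auto
    qed (use r in \<open>auto intro!: has_field_derivative_at_within[OF c', simplified] continuous_intros cc\<close>)
    also have "integral {-r..r} (\<lambda>x. u x t * (- \<kappa> * c x)) = - \<kappa> * A r t"
      unfolding A_def Henstock_Kurzweil_Integration.integral_mult_right[symmetric] by (simp add: mult_ac)
    finally have "integral {-r..r} (\<lambda>x. ut x t * c x) = - \<mu> * A r t + (1 - \<sigma> * \<epsilon>) * (P r t - P (-r) t) + F r"
      unfolding P_def \<mu>_def by (simp add: algebra_simps)
    with d show ?thesis by simp
  qed
  have cA: "continuous_on {0..T} (A r)" if "0 < r" "r < pi" for r
  proof -
    have "continuous_on ({0..T} \<times> {-r..r}) (\<lambda>p. (\<lambda>(x,t). u x t) (snd p, fst p))"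
      by (rule continuous_on_compose2[OF cont_u]) (use that in \<open>auto intro!: continuous_intros\<close>)
    then have "continuous_on ({0..T} \<times> {-r..r}) (\<lambda>p. u (snd p) (fst p) * c (snd p))"
      by (intro continuous_intros continuous_on_compose2[OF cc(1)[of UNIV]]) auto
    then have "continuous_on {0..T} (\<lambda>t. integral (cbox (-r) r) (\<lambda>x. u x t * c x))"
      by (intro integral_continuous_on_param) (simp add: case_prod_unfold)
    then show ?thesis by (simp add: A_def[abs_def])
  qed
  have cP: "continuous_on ({-pi..pi} \<times> {0..T}) (\<lambda>(x,t). P x t)"
  proof -
    have "continuous_on ({-pi..pi} \<times> {0..T}) (\<lambda>p. ux (fst p) (snd p) * c (fst p) - u (fst p) (snd p) * c' (fst p))"
      using cont_u cont_ux unfolding case_prod_unfold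
      by (intro continuous_intros continuous_on_compose2[OF cc(1)[of UNIV]] continuous_on_compose2[OF cc(2)[of UNIV]]) auto
    then show ?thesis by (simp add: P_def case_prod_unfold)
  qed
  \<comment> \<open>\<open>P\<close> involves only \<open>u\<close> and \<open>ux\<close>, so it is
    uniformly continuous on the closed rectangle and \<open>\<delta>\<close> does not depend on
    \<open>t\<close>. Each of the two ends costs \<open>e / 2\<close>.\<close>
  have uP: "\<exists>\<delta>>0. \<forall>r t. 0 < r \<longrightarrow> pi - \<delta> < r \<longrightarrow> r < pi \<longrightarrow> t \<in> {0..T} \<longrightarrow> \<bar>P r t - P (-r) t\<bar> \<le> e"
    if "e > 0" for e
  proof -
    have "uniformly_continuous_on ({-pi..pi} \<times> {0..T}) (\<lambda>(x,t). P x t)"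
      by (rule compact_uniformly_continuous[OF cP]) (intro compact_Times compact_Icc)
    then obtain \<delta> where \<delta>: "\<delta> > 0" and
      *: "\<And>p q. p \<in> {-pi..pi} \<times> {0..T} \<Longrightarrow> q \<in> {-pi..pi} \<times> {0..T} \<Longrightarrow> dist q p < \<delta> \<Longrightarrow>
        dist ((\<lambda>(x,t). P x t) q) ((\<lambda>(x,t). P x t) p) < e / 2"
      using \<open>e > 0\<close> unfolding uniformly_continuous_on_def by (metis half_gt_zero)
    have "\<bar>P r t - P (-r) t\<bar> \<le> e" if r: "0 < r" "pi - \<delta> < r" "r < pi" and t: "t \<in> {0..T}" for r t
    proof -
      have "P (-pi) t = P pi t" using periodic[OF t] per by (simp add: P_def)
      moreover have "\<bar>P r t - P pi t\<bar> < e / 2"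
        using *[of "(pi, t)" "(r, t)"] r t by (auto simp: dist_Pair_Pair dist_real_def)
      moreover have "\<bar>P (-r) t - P (-pi) t\<bar> < e / 2"
        using *[of "(-pi, t)" "(-r, t)"] r t by (auto simp: dist_Pair_Pair dist_real_def)
      ultimately show ?thesis by linarith
    qed
    with \<delta> show ?thesis by blast
  qed
  have main: "exp (\<mu> * t) * A pi t = h t * F pi" if t: "t \<in> {0..T}" for t
  proof (cases "t = 0")
    case True
    have "A pi 0 = integral {-pi..pi} (\<lambda>x. 0)"
      unfolding A_def by (rule Henstock_Kurzweil_Integration.integral_cong) (simp add: initial)
    then show ?thesis using True h0 by simp
  next
    case False
    then have t0: "t > 0" using t by simp
    have cut: "continuous_on {-pi..pi} (\<lambda>x. u x t)" by (rule continuous_on_slice[OF cont_u _ t]) simp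
    define Q where "Q x = exp (\<mu> * t) * (u x t * c x) - h t * (f x * c x)" for x
    have cQ: "continuous_on {-pi..pi} Q"
      unfolding Q_def by (intro continuous_intros cut cc cont_f)
    have Qr: "integral {-r..r} Q = exp (\<mu> * t) * A r t - h t * F r" if "r \<le> pi" for r
      unfolding Q_def A_def F_def
      by (intro integral_unique has_integral_diff has_integral_mult_right integrable_integral
        integrable_continuous_real continuous_intros continuous_on_subset[OF cut] cc continuous_on_subset[OF cont_f])
        (use that in auto)
    have "integral {-pi..pi} Q = 0"
    proof (rule integral_symmetric_eq_0_if_inner_small[OF pi_gt_zero cQ])
      fix e :: real assume e: "e > 0"
      \<comment> \<open>Collects the factors of the later mean value estimate: the length
        \<open>t \<le> T\<close>, the bound for \<open>exp (\<mu> * z)\<close>, and the coefficient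
        of the boundary term. Dividing by \<open>M + 1\<close> avoids a zero denominator.\<close>
      define M where "M = T * (exp (\<bar>\<mu>\<bar> * T) * \<bar>1 - \<sigma> * \<epsilon>\<bar>)"
      have M: "M \<ge> 0" using T by (simp add: M_def)
      obtain \<delta> where \<delta>: "\<delta> > 0" "\<And>r t. 0 < r \<Longrightarrow> pi - \<delta> < r \<Longrightarrow> r < pi \<Longrightarrow> t \<in> {0..T} \<Longrightarrow> \<bar>P r t - P (-r) t\<bar> \<le> e / (M + 1)"
        using uP[of "e / (M + 1)"] e M by auto
      have "\<bar>integral {-r..r} Q\<bar> \<le> e" if r: "0 < r" "pi - \<delta> < r" "r < pi" for r
      proof -
        \<comment> \<open>After multiplication by the integrating factor, the terms with
          \<open>\<mu>\<close> and \<open>F\<close> cancel in the derivative and only boundary terms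
          are left. The mean value theorem needs that derivative only at interior times.\<close>
        define W where "W s = exp (\<mu> * s) * A r s - h s * F r" for s
        have dW: "(W has_real_derivative exp (\<mu> * s) * ((1 - \<sigma> * \<epsilon>) * (P r s - P (-r) s))) (at s)"
          if "s \<in> {0<..<T}" for s
          unfolding W_def
          by (rule derivative_eq_intros dA[OF r(1,3) that] dh refl)+ (simp add: algebra_simps)
        have ch: "continuous_on {0..t} h"
          by (rule DERIV_continuous_on[OF has_field_derivative_at_within[OF dh]])
        have "continuous_on {0..t} W"
          unfolding W_def
          by (intro continuous_intros continuous_on_subset[OF cA[OF r(1,3)]] ch) (use t in auto)
        then obtain l z where z: "0 < z" "z < t" "DERIV W z :> l" "W t - W 0 = (t - 0) * l"
          using MVT[OF t0, of W] dW t unfolding real_differentiable_def by (metis greaterThanLessThan_iff atLeastAtMost_iff less_le_trans)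
        have zT: "z \<in> {0<..<T}" "z \<in> {0..T}" using z t by auto
        have l: "l = exp (\<mu> * z) * ((1 - \<sigma> * \<epsilon>) * (P r z - P (-r) z))"
          using DERIV_unique[OF z(3) dW[OF zT(1)]] .
        have "\<mu> * z \<le> \<bar>\<mu>\<bar> * z" using zT by (intro mult_right_mono) auto
        also have "\<dots> \<le> \<bar>\<mu>\<bar> * T" using zT by (intro mult_left_mono) auto
        finally have "exp (\<mu> * z) \<le> exp (\<bar>\<mu>\<bar> * T)" by simp
        then have "\<bar>l\<bar> \<le> exp (\<bar>\<mu>\<bar> * T) * (\<bar>1 - \<sigma> * \<epsilon>\<bar> * (e / (M + 1)))"
          unfolding l abs_mult abs_exp_cancel
          using \<delta>(2)[OF r zT(2)] by (intro mult_mono) auto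
        then have "t * \<bar>l\<bar> \<le> T * (exp (\<bar>\<mu>\<bar> * T) * (\<bar>1 - \<sigma> * \<epsilon>\<bar> * (e / (M + 1))))"
          using t t0 T by (intro mult_mono) auto
        also have "\<dots> = M * (e / (M + 1))" by (simp add: M_def)
        also have "\<dots> \<le> e" using M e by (simp add: field_simps)
        finally have "\<bar>W t - W 0\<bar> \<le> e" using z t0 by (simp add: abs_mult)
        moreover have "W 0 = 0"
        proof -
          have "A r 0 = integral {-r..r} (\<lambda>x. 0)"
            unfolding A_def by (rule Henstock_Kurzweil_Integration.integral_cong) (use r in \<open>simp add: initial\<close>)
          then show ?thesis by (simp add: W_def h0)
        qed
        ultimately show ?thesis using Qr[of r] r by (simp add: W_def)
      qed
      with \<delta>(1) show "\<exists>\<delta>>0. \<forall>r. 0 < r \<longrightarrow> pi - \<delta> < r \<longrightarrow> r < pi \<longrightarrow> \<bar>integral {-r..r} Q\<bar> \<le> e"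
        by blast
    qed
    then show ?thesis using Qr[of pi] by simp
  qed
  have "A pi T = integral {-pi..pi} (\<lambda>x. 0)"
    unfolding A_def by (rule Henstock_Kurzweil_Integration.integral_cong) (simp add: final)
  then have "F pi = 0" using main[of T] hT T by simp
  then have "A pi t = 0" using main[OF t] by simp
  then show ?thesis by (simp add: A_def)
qed

lemma zero_data_unique:
  assumes T: "T > 0" and R: "regular_solution T \<epsilon> (\<lambda>_. 0) (\<lambda>_. 0) u f"
  shows "\<And>x t. x \<in> {-pi..pi} \<Longrightarrow> t \<in> {0..T} \<Longrightarrow> u x t = 0" and "\<And>x. x \<in> {-pi..pi} \<Longrightarrow> f x = 0"
proof -
  obtain ux uxx ut where "regular_solution_derivatives T \<epsilon> (\<lambda>_. 0) (\<lambda>_. 0) u f ux uxx ut"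
    using R unfolding regular_solution_iff by (elim exE) (rule that)
  then interpret regular_solution_derivatives T \<epsilon> "\<lambda>_. 0" "\<lambda>_. 0" u f ux uxx ut .
  show u0: "u x t = 0" if x: "x \<in> {-pi..pi}" and t: "t \<in> {0..T}" for x t
  proof (rule eq_0_if_fourier_coeffs_0[where f = "\<lambda>x. u x t", OF _ _ _ x])
    show "continuous_on {-pi..pi} (\<lambda>x. u x t)"
      using t by (intro continuous_on_slice[OF cont_u]) auto
    fix k :: nat
    show "integral {-pi..pi} (\<lambda>x. u x t * cos (real k * x)) = 0"
      by (rule zero_data_moment_eq_0[OF T R, where c' = "\<lambda>x. - real k * sin (real k * x)" and \<kappa> = "real k ^ 2" and \<sigma> = 1])
        (use t in \<open>auto intro!: derivative_eq_intros simp: power2_eq_square\<close>)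
    show "integral {-pi..pi} (\<lambda>x. u x t * sin (real k * x)) = 0"
      by (rule zero_data_moment_eq_0[OF T R, where c' = "\<lambda>x. real k * cos (real k * x)" and \<kappa> = "real k ^ 2" and \<sigma> = "-1"])
        (use t in \<open>auto intro!: derivative_eq_intros simp: power2_eq_square\<close>)
  qed
  have f0: "f x = 0" if x: "x \<in> {-pi<..<pi}" for x
  proof -
    \<comment> \<open>Any interior time serves, since \<open>f\<close> does not depend on
      \<open>t\<close>.\<close>
    define t where "t = T / 2"
    have t: "t \<in> {0<..<T}" "t \<in> {0..T}" using T by (auto simp: t_def)
    \<comment> \<open>The derivatives are arbitrary witnesses, so they vanish only by uniqueness of
      the derivative on an open set where the function is 0; the endpoint values of \<open>f\<close>
      then come from continuity.\<close>
    have loc: "d = 0" if "(g has_real_derivative d) (at y)" "open S" "y \<in> S" "\<And>z. z \<in> S \<Longrightarrow> g z = 0"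
      for g :: "real \<Rightarrow> real" and d y S
      using has_field_derivative_transform_within_open[OF that(1-3), of "\<lambda>_. 0"] that(4)
      by (metis DERIV_const DERIV_unique)
    have ux0: "ux y t = 0" if y: "y \<in> {-pi<..<pi}" for y
    proof (rule loc[where S = "{-pi<..<pi}" and y = y and g = "\<lambda>y. u y t"])
      have "at y within {-pi..pi} = at y" using y by (intro at_within_interior) simp
      then show "((\<lambda>y. u y t) has_real_derivative ux y t) (at y)"
        using DERIV_u_x[of y t] y t by auto
    qed (use y u0 t in auto)
    have uxx0: "uxx y t = 0" if y: "y \<in> {-pi<..<pi}" for y
      by (rule loc[OF DERIV_ux_x[OF y t(1)] _ y ux0]) auto
    have "ut x t = 0"
      by (rule loc[OF DERIV_u_t[OF x t(1)], of "{0<..<T}"]) (use x t u0 in auto)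
    then show ?thesis using pde[OF x t(1)] uxx0[of x] uxx0[of "-x"] x by auto
  qed
  show "f x = 0" if "x \<in> {-pi..pi}" for x
    using continuous_constant_on_closure[of "{-pi<..<pi}" f 0 x] cont_f f0 that by auto
qed

lemma regular_solution_diff:
  assumes "regular_solution T \<epsilon> \<phi> \<psi> u f" "regular_solution T \<epsilon> \<phi> \<psi> v g"
  shows "regular_solution T \<epsilon> (\<lambda>_. 0) (\<lambda>_. 0) (\<lambda>x t. u x t - v x t) (\<lambda>x. f x - g x)"
proof -
  obtain ux uxx ut where "regular_solution_derivatives T \<epsilon> \<phi> \<psi> u f ux uxx ut"
    using assms(1) unfolding regular_solution_iff by (elim exE) (rule that)
  then interpret U: regular_solution_derivatives T \<epsilon> \<phi> \<psi> u f ux uxx ut .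
  obtain vx vxx vt where "regular_solution_derivatives T \<epsilon> \<phi> \<psi> v g vx vxx vt"
    using assms(2) unfolding regular_solution_iff by (elim exE) (rule that)
  then interpret V: regular_solution_derivatives T \<epsilon> \<phi> \<psi> v g vx vxx vt .
  have cd: "continuous_on S (\<lambda>(x,t). a x t - b x t)"
    if "continuous_on S (\<lambda>(x,t). a x t)" "continuous_on S (\<lambda>(x,t). b x t)"
    for S and a b :: "real \<Rightarrow> real \<Rightarrow> real"
    using continuous_on_diff[OF that] by (simp add: case_prod_unfold)
  have "regular_solution_derivatives T \<epsilon> (\<lambda>_. 0) (\<lambda>_. 0) (\<lambda>x t. u x t - v x t) (\<lambda>x. f x - g x)
    (\<lambda>x t. ux x t - vx x t) (\<lambda>x t. uxx x t - vxx x t) (\<lambda>x t. ut x t - vt x t)"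
  proof
    fix x t assume xt: "x \<in> {-pi<..<pi}" "t \<in> {0<..<T}"
    then show "ut x t - vt x t - (uxx x t - vxx x t) + \<epsilon> * (uxx (-x) t - vxx (-x) t) = f x - g x"
      using U.pde[OF xt] V.pde[OF xt] by (simp add: right_diff_distrib)
  qed (simp_all add: cd continuous_on_diff DERIV_diff U.cont_u V.cont_u U.cont_f V.cont_f U.cont_ux V.cont_ux
      U.cont_uxx V.cont_uxx U.cont_ut V.cont_ut U.DERIV_u_x V.DERIV_u_x U.DERIV_ux_x V.DERIV_ux_x
      U.DERIV_u_t V.DERIV_u_t U.periodic V.periodic U.initial V.initial U.final V.final)
  then show ?thesis unfolding regular_solution_iff by (intro exI)
qed

subsection \<open>Existence\<close>

text \<open>At \<open>t = T\<close> the exponential quotients cancel and the series become those of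
  \<open>\<psi>\<close> minus those of \<open>\<phi>\<close>. Expanding \<open>\<phi> x\<close> and
  \<open>\<psi> x\<close> themselves finishes the comparison.\<close>

lemma sol_u_terminal:
  assumes T: "T > 0" and \<epsilon>: "\<bar>\<epsilon>\<bar> < 1"
    and P: "periodic_data \<phi> \<phi>1 \<phi>2 \<phi>3" "periodic_data \<psi> \<psi>1 \<psi>2 \<psi>3" and x: "x \<in> {-pi..pi}"
  shows "sol_u T \<epsilon> \<phi> \<psi> \<phi>3 \<psi>3 x T = \<psi> x"
proof -
  have pos: "1 - \<epsilon> > 0" "1 + \<epsilon> > 0" using \<epsilon> by auto
  have *: "(1 - exp (- \<mu> * (real (Suc n))\<^sup>2 * T)) * a / ((1 - exp (- \<mu> * (real (Suc n))\<^sup>2 * T)) * b) = a / b"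
    if "\<mu> > 0" for \<mu> a b :: real and n
    using that T growth_pos[OF that T, of n] by (simp add: growth_def decay_def)
  have summ: "summable (\<lambda>n. c n / real (Suc n) ^ 3 * w n)"
    if "summable (\<lambda>n. \<bar>c n\<bar> / real (Suc n))" "\<And>n. \<bar>w n\<bar> \<le> 1" for c w :: "nat \<Rightarrow> real"
    by (rule summable_comparison_test'[OF that(1)]) (simp only: real_norm_def fourier_term_bound that(2))
  note sm = periodic_data_summable[OF P(1)] periodic_data_summable[OF P(2)]
  have "(\<Sum>n. (fc2 \<phi>3 (Suc n) - fc2 \<psi>3 (Suc n)) / real (Suc n) ^ 3 * cos (real (Suc n) * x))
    = (\<Sum>n. fc2 \<phi>3 (Suc n) / real (Suc n) ^ 3 * cos (real (Suc n) * x))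
      - (\<Sum>n. fc2 \<psi>3 (Suc n) / real (Suc n) ^ 3 * cos (real (Suc n) * x))"
    unfolding diff_divide_distrib left_diff_distrib
    by (rule suminf_diff[symmetric]; rule summ; (rule sm | simp))
  moreover have "(\<Sum>n. (fc1 \<phi>3 (Suc n) - fc1 \<psi>3 (Suc n)) / real (Suc n) ^ 3 * sin (real (Suc n) * x))
    = (\<Sum>n. fc1 \<phi>3 (Suc n) / real (Suc n) ^ 3 * sin (real (Suc n) * x))
      - (\<Sum>n. fc1 \<psi>3 (Suc n) / real (Suc n) ^ 3 * sin (real (Suc n) * x))"
    unfolding diff_divide_distrib left_diff_distrib
    by (rule suminf_diff[symmetric]; rule summ; (rule sm | simp))
  moreover have "sol_u T \<epsilon> \<phi> \<psi> \<phi>3 \<psi>3 x T = \<phi> x + (mean0 \<psi> - mean0 \<phi>)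
    - (\<Sum>n. (fc2 \<phi>3 (Suc n) - fc2 \<psi>3 (Suc n)) / real (Suc n) ^ 3 * cos (real (Suc n) * x))
    + (\<Sum>n. (fc1 \<phi>3 (Suc n) - fc1 \<psi>3 (Suc n)) / real (Suc n) ^ 3 * sin (real (Suc n) * x))"
    unfolding sol_u_def Let_def *[OF pos(1)] *[OF pos(2)] using T by simp
  ultimately show ?thesis
    using periodic_data_fourier_series[OF P(1) x] periodic_data_fourier_series[OF P(2) x] by linarith
qed

text \<open>\<open>\<phi>\<close> is kept as a summand instead of being expanded, so its classical
  derivatives are available and the remaining terms vanish at \<open>t = 0\<close>. Its contribution
  to the equation is exactly \<open>- \<phi>2 x + \<epsilon> * \<phi>2 (-x)\<close> in
  \<open>f\<close>.\<close>

lemma sol_regular: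
  assumes T: "T > 0" and \<epsilon>: "\<bar>\<epsilon>\<bar> < 1"
    and P: "periodic_data \<phi> \<phi>1 \<phi>2 \<phi>3" "periodic_data \<psi> \<psi>1 \<psi>2 \<psi>3"
  shows "regular_solution T \<epsilon> \<phi> \<psi> (sol_u T \<epsilon> \<phi> \<psi> \<phi>3 \<psi>3) (sol_f T \<epsilon> \<phi> \<psi> \<phi>2 \<phi>3 \<psi>3)"
proof -
  have pos: "1 - \<epsilon> > 0" "1 + \<epsilon> > 0" using \<epsilon> by auto
  define C where "C = mean0 \<psi> - mean0 \<phi>"
  \<comment> \<open>Sine integrals of the third derivative represent cosine coefficients of the
    data, so \<open>fc2\<close> feeds the even modes with conductivity
    \<open>1 - \<epsilon>\<close>, and \<open>fc1\<close> the odd modes with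
    \<open>1 + \<epsilon>\<close>.\<close>
  define \<gamma>1 where "\<gamma>1 n = (fc2 \<phi>3 (Suc n) - fc2 \<psi>3 (Suc n)) / (growth (1 - \<epsilon>) n T * real (Suc n))" for n
  define \<gamma>2 where "\<gamma>2 n = (fc1 \<phi>3 (Suc n) - fc1 \<psi>3 (Suc n)) / (growth (1 + \<epsilon>) n T * real (Suc n))" for n
  note sm = periodic_data_summable[OF P(1)] periodic_data_summable[OF P(2)]
  have sd: "summable (\<lambda>n. \<bar>a n - b n\<bar> / real (Suc n))"
    if "summable (\<lambda>n. \<bar>a n\<bar> / real (Suc n))" "summable (\<lambda>n. \<bar>b n\<bar> / real (Suc n))" for a b :: "nat \<Rightarrow> real"
  proof (rule summable_comparison_test'[OF summable_add[OF that]])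
    fix n
    have "\<bar>a n - b n\<bar> / real (Suc n) \<le> (\<bar>a n\<bar> + \<bar>b n\<bar>) / real (Suc n)"
      by (intro divide_right_mono) auto
    then show "norm (\<bar>a n - b n\<bar> / real (Suc n)) \<le> \<bar>a n\<bar> / real (Suc n) + \<bar>b n\<bar> / real (Suc n)"
      by (simp add: add_divide_distrib)
  qed
  have \<gamma>1: "summable (\<lambda>n. \<bar>\<gamma>1 n\<bar>)"
    unfolding \<gamma>1_def by (rule summable_divide_growth[OF pos(1) T sd[OF sm(2) sm(4)]])
  have \<gamma>2: "summable (\<lambda>n. \<bar>\<gamma>2 n\<bar>)"
    unfolding \<gamma>2_def by (rule summable_divide_growth[OF pos(2) T sd[OF sm(1) sm(3)]])
  define u1 where "u1 = modes (growth (1 - \<epsilon>)) (\<lambda>n. \<gamma>1 n / real (Suc n) / real (Suc n)) 0"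
  define u1x where "u1x = modes (growth (1 - \<epsilon>)) (\<lambda>n. \<gamma>1 n / real (Suc n)) (0 - pi/2)"
  define u1xx where "u1xx x t = - modes (growth (1 - \<epsilon>)) \<gamma>1 0 x t" for x t
  define u1t where "u1t x t = (1 - \<epsilon>) * modes (decay (1 - \<epsilon>)) \<gamma>1 0 x t" for x t
  define u2 where "u2 = modes (growth (1 + \<epsilon>)) (\<lambda>n. \<gamma>2 n / real (Suc n) / real (Suc n)) (pi/2)"
  define u2x where "u2x = modes (growth (1 + \<epsilon>)) (\<lambda>n. \<gamma>2 n / real (Suc n)) (pi/2 - pi/2)"
  define u2xx where "u2xx x t = - modes (growth (1 + \<epsilon>)) \<gamma>2 (pi/2) x t" for x t
  define u2t where "u2t x t = (1 + \<epsilon>) * modes (decay (1 + \<epsilon>)) \<gamma>2 (pi/2) x t" for x t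
  note r1 = modes_regular[OF pos(1) \<gamma>1, where \<theta> = 0, folded u1_def u1x_def u1xx_def u1t_def]
  note r2 = modes_regular[OF pos(2) \<gamma>2, where \<theta> = "pi/2", folded u2_def u2x_def u2xx_def u2t_def]
  have u_eq: "sol_u T \<epsilon> \<phi> \<psi> \<phi>3 \<psi>3 x t = \<phi> x + t / T * C - u1 x t + u2 x t" for x t
    unfolding sol_u_eq_modes C_def u1_def u2_def \<gamma>1_def \<gamma>2_def ..
  have f_eq: "sol_f T \<epsilon> \<phi> \<psi> \<phi>2 \<phi>3 \<psi>3 x = - \<phi>2 x + \<epsilon> * \<phi>2 (- x) + C / T
    - (1 - \<epsilon>) * modes (\<lambda>_ _. 1) \<gamma>1 0 x t + (1 + \<epsilon>) * modes (\<lambda>_ _. 1) \<gamma>2 (pi/2) x t" for x t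
    using sol_f_eq_modes[OF \<gamma>1[unfolded \<gamma>1_def] \<gamma>2[unfolded \<gamma>2_def], of \<phi> \<psi> \<phi>2 x t]
    unfolding C_def \<gamma>1_def \<gamma>2_def .
  have d\<phi>: "\<And>x. x \<in> {-pi..pi} \<Longrightarrow> (\<phi> has_real_derivative \<phi>1 x) (at x within {-pi..pi})"
    and d\<phi>1: "\<And>x. x \<in> {-pi..pi} \<Longrightarrow> (\<phi>1 has_real_derivative \<phi>2 x) (at x within {-pi..pi})"
    and c\<phi>2: "continuous_on {-pi..pi} \<phi>2"
    and per: "\<phi> (-pi) = \<phi> pi" "\<phi>1 (-pi) = \<phi>1 pi"
    using P(1) unfolding periodic_data_def by blast+
  have c\<phi>: "continuous_on {-pi..pi} \<phi>" by (rule DERIV_continuous_on[OF d\<phi>])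
  have c\<phi>1: "continuous_on {-pi..pi} \<phi>1" by (rule DERIV_continuous_on[OF d\<phi>1])
  have d\<phi>1': "(\<phi>1 has_real_derivative \<phi>2 x) (at x)" if "x \<in> {-pi<..<pi}" for x
  proof -
    have "at x within {-pi..pi} = at x" using that by (intro at_within_interior) simp
    then show ?thesis using d\<phi>1[of x] that by auto
  qed
  have cfst: "continuous_on (X \<times> Y) (\<lambda>p. g (fst p))" if "continuous_on X g" for X Y :: "real set" and g :: "real \<Rightarrow> real"
    by (rule continuous_on_compose2[OF that]) (auto intro!: continuous_intros)
  have csub: "continuous_on (X \<times> Y) (\<lambda>p. w (fst p) (snd p))"
    if "continuous_on (UNIV \<times> {0..}) (\<lambda>(x,t). w x t)" "Y \<subseteq> {0..}" for w :: "real \<Rightarrow> real \<Rightarrow> real" and X Y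
    using continuous_on_subset[OF that(1), of "X \<times> Y"] that(2) by (auto simp: case_prod_unfold)
  have ceq: "continuous_on S (\<lambda>(x,t). w x t) \<longleftrightarrow> continuous_on S (\<lambda>p. w (fst p) (snd p))" for S and w :: "real \<Rightarrow> real \<Rightarrow> real"
    by (simp add: case_prod_unfold)
  have "regular_solution_derivatives T \<epsilon> \<phi> \<psi> (sol_u T \<epsilon> \<phi> \<psi> \<phi>3 \<psi>3) (sol_f T \<epsilon> \<phi> \<psi> \<phi>2 \<phi>3 \<psi>3)
    (\<lambda>x t. \<phi>1 x - u1x x t + u2x x t) (\<lambda>x t. \<phi>2 x - u1xx x t + u2xx x t) (\<lambda>x t. C / T - u1t x t + u2t x t)"
  proof
    show "continuous_on ({-pi..pi} \<times> {0..T}) (\<lambda>(x, t). sol_u T \<epsilon> \<phi> \<psi> \<phi>3 \<psi>3 x t)"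
      unfolding ceq u_eq
      by (intro continuous_intros cfst c\<phi> csub r1(1) r2(1)) (use T in auto)
    have m: "continuous_on (UNIV \<times> {0..}) (\<lambda>(x, t). modes (\<lambda>_ _. 1) \<gamma> \<theta> x t)"
      if "summable (\<lambda>n. \<bar>\<gamma> n\<bar>)" for \<gamma> \<theta>
      by (rule continuous_on_modes[OF that]) auto
    have "continuous_on {-pi..pi} (\<lambda>x. \<phi>2 (-x))"
      by (rule continuous_on_compose2[OF c\<phi>2]) (auto intro!: continuous_intros)
    then show "continuous_on {-pi..pi} (sol_f T \<epsilon> \<phi> \<psi> \<phi>2 \<phi>3 \<psi>3)"
      unfolding f_eq[of _ 0, abs_def]
      by (intro continuous_intros c\<phi>2 continuous_on_slice[OF m[OF \<gamma>1]] continuous_on_slice[OF m[OF \<gamma>2]]) auto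
    show "continuous_on ({-pi..pi} \<times> {0..T}) (\<lambda>(x, t). \<phi>1 x - u1x x t + u2x x t)"
      unfolding ceq
      by (intro continuous_intros cfst c\<phi>1 csub r1(2) r2(2)) auto
    show "continuous_on ({-pi<..<pi} \<times> {0<..<T}) (\<lambda>(x, t). \<phi>2 x - u1xx x t + u2xx x t)"
      unfolding ceq
      by (intro continuous_intros cfst continuous_on_subset[OF c\<phi>2] csub r1(3) r2(3)) auto
    show "continuous_on ({-pi<..<pi} \<times> {0<..<T}) (\<lambda>(x, t). C / T - u1t x t + u2t x t)"
      unfolding ceq
      by (intro continuous_intros csub r1(4) r2(4)) auto
  next
    fix x t :: real assume x: "x \<in> {-pi..pi}" and t: "t \<in> {0..T}"
    then have t0: "t \<ge> 0" by simp
    have "((\<lambda>y. \<phi> y + t / T * C - u1 y t + u2 y t) has_real_derivative \<phi>1 x + 0 - u1x x t + u2x x t)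
        (at x within {-pi..pi})"
      by (intro DERIV_add DERIV_diff d\<phi>[OF x] DERIV_const has_field_derivative_at_within[OF r1(5)[OF t0]]
        has_field_derivative_at_within[OF r2(5)[OF t0]])
    then show "((\<lambda>y. sol_u T \<epsilon> \<phi> \<psi> \<phi>3 \<psi>3 y t) has_real_derivative \<phi>1 x - u1x x t + u2x x t) (at x within {-pi..pi})"
      unfolding u_eq by simp
  next
    fix x t :: real assume x: "x \<in> {-pi<..<pi}" and t: "t \<in> {0<..<T}"
    then have t0: "t \<ge> 0" "t > 0" by auto
    show "((\<lambda>y. \<phi>1 y - u1x y t + u2x y t) has_real_derivative \<phi>2 x - u1xx x t + u2xx x t) (at x)"
      by (intro DERIV_add DERIV_diff d\<phi>1'[OF x] r1(6)[OF t0(1)] r2(6)[OF t0(1)])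
    have "((\<lambda>s. \<phi> x + s / T * C - u1 x s + u2 x s) has_real_derivative 0 + 1 / T * C - u1t x t + u2t x t) (at t)"
      by (intro DERIV_add DERIV_diff DERIV_const DERIV_cmult_right DERIV_cdivide DERIV_ident r1(7) r2(7) t0)
    then show "((\<lambda>s. sol_u T \<epsilon> \<phi> \<psi> \<phi>3 \<psi>3 x s) has_real_derivative C / T - u1t x t + u2t x t) (at t)"
      unfolding u_eq by simp
    \<comment> \<open>By parity the operator \<open>- uxx(x) + \<epsilon> * uxx(-x)\<close>
      multiplies the second derivative of the cosine part by \<open>- (1 - \<epsilon>)\<close> and
      that of the sine part by \<open>- (1 + \<epsilon>)\<close>, as \<open>e1\<close> and
      \<open>e2\<close> require.\<close>
    have 1: "u1xx (-x) t = u1xx x t" unfolding u1xx_def modes_even ..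
    have 2: "u2xx (-x) t = - u2xx x t"
      unfolding u2xx_def using modes_odd[where w = "growth (1 + \<epsilon>)" and t = t, OF \<gamma>2 growth_bound[OF pos(2) t0(1)]] by simp
    have e1: "(1 - \<epsilon>) * modes (\<lambda>_ _. 1) \<gamma>1 0 x t = u1t x t - (1 - \<epsilon>) * u1xx x t"
      and e2: "(1 + \<epsilon>) * modes (\<lambda>_ _. 1) \<gamma>2 (pi/2) x t = u2t x t - (1 + \<epsilon>) * u2xx x t"
      using r1(8)[OF t0(1)] r2(8)[OF t0(1)] by auto
    show "C / T - u1t x t + u2t x t - (\<phi>2 x - u1xx x t + u2xx x t) + \<epsilon> * (\<phi>2 (-x) - u1xx (-x) t + u2xx (-x) t)
      = sol_f T \<epsilon> \<phi> \<psi> \<phi>2 \<phi>3 \<psi>3 x"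
      unfolding f_eq[of x t] 1 2 e1 e2 by (simp add: algebra_simps)
  next
    fix t assume "t \<in> {0..T}"
    show "sol_u T \<epsilon> \<phi> \<psi> \<phi>3 \<psi>3 (-pi) t = sol_u T \<epsilon> \<phi> \<psi> \<phi>3 \<psi>3 pi t"
      unfolding u_eq u1_def u2_def modes_periodic per ..
    show "\<phi>1 (-pi) - u1x (-pi) t + u2x (-pi) t = \<phi>1 pi - u1x pi t + u2x pi t"
      unfolding u1x_def u2x_def modes_periodic per ..
  next
    fix x assume x: "x \<in> {-pi..pi}"
    show "sol_u T \<epsilon> \<phi> \<psi> \<phi>3 \<psi>3 x 0 = \<phi> x"
      by (simp add: sol_u_def)
    show "sol_u T \<epsilon> \<phi> \<psi> \<phi>3 \<psi>3 x T = \<psi> x"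
      by (rule sol_u_terminal[OF T \<epsilon> P x])
  qed
  then show ?thesis unfolding regular_solution_iff by (intro exI)
qed

theorem theorem3:
  fixes T \<epsilon> :: real
    and \<phi> \<phi>1 \<phi>2 \<phi>3 \<psi> \<psi>1 \<psi>2 \<psi>3 :: "real \<Rightarrow> real"
  assumes "T > 0" and "\<epsilon> \<noteq> 0" and "\<bar>\<epsilon>\<bar> < 1"
    and "periodic_data \<phi> \<phi>1 \<phi>2 \<phi>3"
    and "periodic_data \<psi> \<psi>1 \<psi>2 \<psi>3"
  shows "regular_solution T \<epsilon> \<phi> \<psi> (sol_u T \<epsilon> \<phi> \<psi> \<phi>3 \<psi>3) (sol_f T \<epsilon> \<phi> \<psi> \<phi>2 \<phi>3 \<psi>3)
    \<and> (\<forall>u f. regular_solution T \<epsilon> \<phi> \<psi> u f \<longrightarrow>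
          (\<forall>x\<in>{-pi..pi}. \<forall>t\<in>{0..T}. u x t = sol_u T \<epsilon> \<phi> \<psi> \<phi>3 \<psi>3 x t) \<and>
          (\<forall>x\<in>{-pi..pi}. f x = sol_f T \<epsilon> \<phi> \<psi> \<phi>2 \<phi>3 \<psi>3 x))"
proof (intro conjI allI impI)
  show sol: "regular_solution T \<epsilon> \<phi> \<psi> (sol_u T \<epsilon> \<phi> \<psi> \<phi>3 \<psi>3) (sol_f T \<epsilon> \<phi> \<psi> \<phi>2 \<phi>3 \<psi>3)"
    by (rule sol_regular[OF assms(1,3,4,5)])
  fix u f assume "regular_solution T \<epsilon> \<phi> \<psi> u f"
  note diff = zero_data_unique[OF assms(1) regular_solution_diff[OF this sol]]
  show "\<forall>x\<in>{-pi..pi}. \<forall>t\<in>{0..T}. u x t = sol_u T \<epsilon> \<phi> \<psi> \<phi>3 \<psi>3 x t"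
    using diff(1) by fastforce
  show "\<forall>x\<in>{-pi..pi}. f x = sol_f T \<epsilon> \<phi> \<psi> \<phi>2 \<phi>3 \<psi>3 x"
    using diff(2) by fastforce
qed

end
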